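(* Let $(u,v)\in\overline{AC}_{loc}(T)\times L^1(T)$ with $u(0)=\bar u_0$. Let $x:[0,T]\to\mathbb R^n$ be a $BV_{loc}$ graph completion solution on $[0,T]$ of $$\dot x=g_0(x,u,v)+\sum_{i=1}^m g_i(x,u)\dot u_i,\quad x(0)=\bar x_0,\ u(0)=\bar u_0,$$ corresponding to $(u,v)$, whose restriction to $[0,T[$ belongs to $AC_{loc}([0,T[,\mathbb R^n)$. Then: (i) $x$ coincides on $[0,T[$ with the Carathéodory solution $x[\bar x_0,\bar u_0,u,v]$; (ii) $x$ is an $AC_{loc}$ solution on $[0,T]$ if $(x,u)$ is associated to a graph completion with BV loops; and, in general, $x$ is an $AC_{loc}$ solution on $[0,T]$ if and only if $(x,u)(T)\in(x,u)_{set}(T)$.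
   Context: Standing setting. $T>0$; $U\subset\mathbb R^m$ and $V\subset\mathbb R^l$ are compact; $(\bar x_0,\bar u_0)\in\mathbb R^n\times U$. The map $g_0:\mathbb R^n\times U\times V\to\mathbb R^n$ is continuous and $(x,u)\mapsto g_0(x,u,v)$ is locally Lipschitz on $\mathbb R^n\times U$ uniformly in $v\in V$; for $i=1,\dots,m$, $g_i:\mathbb R^n\times U\to\mathbb R^n$ is locally Lipschitz; there is $M>0$ with $|(g_0(x,u,v),g_1(x,u),\dots,g_m(x,u))|\le M(1+|(x,u)|)$ for all $(x,u,v)$. $AC_{loc}([0,T[,E)$ is the set of maps $[0,T[\to E$ absolutely continuous on $[0,t]$ for every $t<T$ (total variation on $[0,T[$ possibly infinite). $\overline{AC}_{loc}(T)$ is the set of $u:[0,T]\to U$ whose restriction to $[0,T[$ is in $AC_{loc}([0,T[,U)$ and with $u(T)=\lim_j u(\tau_j)$ for some $\tau_j\nearrow T$. $L^1(T)$ is the set of (classes of) Lebesgue integrable maps $v:[0,T]\to V$, with Borel measurable representatives used when pointwise values are needed. For $u\in\overline{AC}_{loc}(T)$ with $u(0)=\bar u_0$ and $v\in L^1(T)$, $x[\bar x_0,\bar u_0,u,v]$ is the unique Carathéodory solution on $[0,T[$ of the control system. $(x,u)_{set}(T):=\{\lim_j(x,u)(\tau_j):\ \text{for some }\tau_j\nearrow T\}$. An $AC_{loc}$ solution on $[0,T]$ (corresponding to $(u,v)$) is a map $x:[0,T]\to\mathbb R^n$ which equals $x[\bar x_0,\bar u_0,u,v]$ on $[0,T[$,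 is bounded there, and satisfies $(x(T),u(T))\in(x,u)_{set}(T)$. Feasible space-time controls: $\Gamma(T;\bar u_0)$ is the set of $(\varphi_0,\varphi,\psi,S)$ with $0<S\le+\infty$, $(\varphi_0,\varphi):[0,S[\to[0,+\infty[\times U$ $1$-Lipschitz, $\psi:[0,S[\to V$ measurable, $\varphi_0(0)=0$, $\varphi(0)=\bar u_0$, $\varphi_0'\ge0$ and $\varphi_0'+|\varphi'|=1$ a.e., $\lim_{s\to S}\varphi_0(s)=T$. The corresponding $\xi=\xi[\bar x_0,\bar u_0,\varphi_0,\varphi,\psi]$ is the solution on $[0,S[$ of $$\xi'(s)=g_0(\xi,\varphi,\psi)\varphi_0'(s)+\sum_{i=1}^m g_i(\xi,\varphi)\varphi_i'(s),\qquad \xi(0)=\bar x_0.$$ If $S<+\infty$, $(\xi,\varphi_0,\varphi)$ is extended to $[0,S]$ by continuity. If $S=+\infty$ and $\xi$ is bounded, put $(\xi,\varphi)_{set}(+\infty):=\{\lim_j(\xi,\varphi)(s_j):\ \text{for some } s_j\nearrow+\infty\}$. $BV_{loc}$ graph completion (for $u:[0,T]\to U$ of bounded variation on $[0,t]$ for all $t<T$, $u(0)=\bar u_0$): $(\varphi_0,\varphi,\psi,S)\in\Gamma(T;\bar u_0)$ is a $BV_{loc}$ graph completion of $(u,v)$ if (1) for every $t\in[0,T[$ there is $s\in[0,S[$ with $(\varphi_0,\varphi,\psi)(s)=(t,u(t),v(t))$; (2) if $S<+\infty$, $(\varphi_0,\varphi)(S)=(T,u(T))$; (3) if $S=+\infty$,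 $\lim_j\varphi(s_j)=u(T)$ for some $s_j\nearrow+\infty$ (abbreviated $(\varphi_0,\varphi)(+\infty)=(T,u(T))$). A clock is an increasing function $\sigma:[0,T]\to[0,S]$ with $(\varphi_0,\varphi)(\sigma(t))=(t,u(t))$ for every $t\in[0,T]$, $\sigma(0)=0$, $\sigma(T)=S$ (when $S=+\infty$ the condition at $t=T$ just means (3), and $\lim_{t\to T^-}\sigma(t)<+\infty$ is allowed). $BV_{loc}$ graph completion solution: given a $BV_{loc}$ graph completion of $(u,v)$ and a clock $\sigma$, with $\xi$ bounded when $S=+\infty$, it is a map $x:[0,T]\to\mathbb R^n$ with $x(t)=\xi(\sigma(t))$ for $t\in[0,T[$, and $x(T)=\xi(S)$ if $S<+\infty$, $(x(T),u(T))\in(\xi,\varphi)_{set}(+\infty)$ if $S=+\infty$; it is said to be associated to that graph completion (and clock). Graph completion with BV loops: a $BV_{loc}$ graph completion $(\varphi_0,\varphi,\psi,S)$ of $(u,v)\in\overline{AC}_{loc}(T)\times L^1(T)$ such that either $S<+\infty$, or $S=+\infty$ and $\mathrm{meas}\{s\ge0:\ \varphi_0'(s)=0\}<+\infty$.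
   Formalization: In the first half of (ii), for S<+∞, the graph completion is also required to satisfy φ_0(s)<T for all s<S (no loop at the final time T); without this the claim fails, since a loop at T can move x(T)=ξ(S) away from lim x(t). *)

theory Defs
  imports "HOL-Analysis.Analysis"
begin

text \<open>
  Horizons may be infinite, so they are extended reals.  Maps on \<open>[0,S[\<close> or \<open>[0,T]\<close> are total
  functions of which only the values on that interval matter.
\<close>

definition horizon :: "ereal \<Rightarrow> real set" where
  "horizon S = {s. 0 \<le> s \<and> ereal s < S}"

definition to_end :: "ereal \<Rightarrow> real filter" where
  "to_end S = (if S = \<infinity> then at_top else at_left (real_of_ereal S))"

definition AC_on :: "real \<Rightarrow> real \<Rightarrow> (real \<Rightarrow> 'a::real_normed_vector) \<Rightarrow> bool" where
  "AC_on a b f \<longleftrightarrow>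
     (\<forall>\<epsilon>>0. \<exists>\<delta>>0. \<forall>(k::nat) c d.
        (\<forall>i<k. a \<le> c i \<and> c i \<le> d i \<and> d i \<le> b) \<and>
        disjoint_family_on (\<lambda>i. {c i<..<d i}) {..<k} \<and>
        (\<Sum>i<k. d i - c i) < \<delta>
        \<longrightarrow> (\<Sum>i<k. norm (f (d i) - f (c i))) < \<epsilon>)"

definition AC_loc :: "ereal \<Rightarrow> (real \<Rightarrow> 'a::real_normed_vector) \<Rightarrow> bool" where
  "AC_loc S f \<longleftrightarrow> (\<forall>s\<in>horizon S. AC_on 0 s f)"

definition BV_on :: "real \<Rightarrow> real \<Rightarrow> (real \<Rightarrow> 'a::real_normed_vector) \<Rightarrow> bool" where
  "BV_on a b f \<longleftrightarrow>
     (\<exists>B. \<forall>(k::nat) p. p ` {..k} \<subseteq> {a..b} \<and> mono_on {..k} p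
        \<longrightarrow> (\<Sum>i<k. norm (f (p (Suc i)) - f (p i))) \<le> B)"

text \<open>The set of limits \<open>lim_j f(s_j)\<close> along sequences \<open>s_j\<close> in \<open>[0,S[\<close> increasing to \<open>S\<close>.\<close>

definition limit_set :: "ereal \<Rightarrow> (real \<Rightarrow> 'a::topological_space) \<Rightarrow> 'a set" where
  "limit_set S f =
     {p. \<exists>s::nat \<Rightarrow> real. range s \<subseteq> horizon S \<and> incseq s \<and>
         (\<lambda>j. ereal (s j)) \<longlonglongrightarrow> S \<and> (\<lambda>j. f (s j)) \<longlonglongrightarrow> p}"

definition AC_loc_bar :: "real \<Rightarrow> 'a::real_normed_vector set \<Rightarrow> (real \<Rightarrow> 'a) set" where
  "AC_loc_bar T U =
     {u. u ` {0..T} \<subseteq> U \<and> AC_loc (ereal T) u \<and> u T \<in> limit_set (ereal T) u}"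

text \<open>Elements of \<open>L^1(T)\<close> are given by Borel measurable representatives.\<close>

definition L1_controls :: "real \<Rightarrow> 'a::euclidean_space set \<Rightarrow> (real \<Rightarrow> 'a) set" where
  "L1_controls T V = {v. v ` {0..T} \<subseteq> V \<and> set_integrable lborel {0..T} v}"

definition locally_lipschitz_uniformly_on ::
  "'a::metric_space set \<Rightarrow> 'p set \<Rightarrow> ('p \<Rightarrow> 'a \<Rightarrow> 'b::metric_space) \<Rightarrow> bool" where
  "locally_lipschitz_uniformly_on X P f \<longleftrightarrow>
     (\<forall>z\<in>X. \<exists>r>0. \<exists>L. \<forall>p\<in>P. L-lipschitz_on (cball z r \<inter> X) (f p))"

text \<open>
  The right-hand side \<open>a g\<^sub>0(x,u,v) + \<Sum>\<^sub>i b\<^sub>i g\<^sub>i(x,u)\<close>: the control system has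
  \<open>a = 1\<close>, \<open>b = u'\<close>, the space-time system \<open>a = \<phi>\<^sub>0'\<close>, \<open>b = \<phi>'\<close>.
\<close>

definition dynamics ::
  "(real^'n \<Rightarrow> real^'m \<Rightarrow> real^'l \<Rightarrow> real^'n) \<Rightarrow> ('m \<Rightarrow> real^'n \<Rightarrow> real^'m \<Rightarrow> real^'n) \<Rightarrow>
   real^'n \<Rightarrow> real^'m \<Rightarrow> real^'l \<Rightarrow> real \<Rightarrow> real^'m \<Rightarrow> real^'n" where
  "dynamics g0 g x u v a b = a *\<^sub>R g0 x u v + (\<Sum>i\<in>UNIV. (b $ i) *\<^sub>R g i x u)"

definition caratheodory_solution ::
  "(real^'n \<Rightarrow> real^'m \<Rightarrow> real^'l \<Rightarrow> real^'n) \<Rightarrow> ('m \<Rightarrow> real^'n \<Rightarrow> real^'m \<Rightarrow> real^'n) \<Rightarrow>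
   real \<Rightarrow> real^'n \<Rightarrow> (real \<Rightarrow> real^'m) \<Rightarrow> (real \<Rightarrow> real^'l) \<Rightarrow> (real \<Rightarrow> real^'n) \<Rightarrow> bool" where
  "caratheodory_solution g0 g T x0 u v x \<longleftrightarrow>
     AC_loc (ereal T) x \<and> x 0 = x0 \<and>
     (AE t in lebesgue_on {0..<T}. \<exists>u'.
        (u has_vector_derivative u') (at t) \<and>
        (x has_vector_derivative dynamics g0 g (x t) (u t) (v t) 1 u') (at t))"

text \<open>\<open>x\<close> agrees on \<open>[0,T[\<close> with the (unique) trajectory \<open>x[x\<^sub>0,u\<^sub>0,u,v]\<close>.\<close>

definition coincides_with_trajectory ::
  "(real^'n \<Rightarrow> real^'m \<Rightarrow> real^'l \<Rightarrow> real^'n) \<Rightarrow> ('m \<Rightarrow> real^'n \<Rightarrow> real^'m \<Rightarrow> real^'n) \<Rightarrow>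
   real \<Rightarrow> real^'n \<Rightarrow> (real \<Rightarrow> real^'m) \<Rightarrow> (real \<Rightarrow> real^'l) \<Rightarrow> (real \<Rightarrow> real^'n) \<Rightarrow> bool" where
  "coincides_with_trajectory g0 g T x0 u v x \<longleftrightarrow>
     caratheodory_solution g0 g T x0 u v x \<and>
     (\<forall>y. caratheodory_solution g0 g T x0 u v y \<longrightarrow> (\<forall>t\<in>{0..<T}. x t = y t))"

definition AC_loc_solution ::
  "(real^'n \<Rightarrow> real^'m \<Rightarrow> real^'l \<Rightarrow> real^'n) \<Rightarrow> ('m \<Rightarrow> real^'n \<Rightarrow> real^'m \<Rightarrow> real^'n) \<Rightarrow>
   real \<Rightarrow> real^'n \<Rightarrow> (real \<Rightarrow> real^'m) \<Rightarrow> (real \<Rightarrow> real^'l) \<Rightarrow> (real \<Rightarrow> real^'n) \<Rightarrow> bool" where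
  "AC_loc_solution g0 g T x0 u v x \<longleftrightarrow>
     coincides_with_trajectory g0 g T x0 u v x \<and>
     bounded (x ` {0..<T}) \<and>
     (x T, u T) \<in> limit_set (ereal T) (\<lambda>t. (x t, u t))"

definition feasible_space_time_controls ::
  "(real^'m) set \<Rightarrow> (real^'l) set \<Rightarrow> real \<Rightarrow> real^'m \<Rightarrow>
   ((real \<Rightarrow> real) \<times> (real \<Rightarrow> real^'m) \<times> (real \<Rightarrow> real^'l) \<times> ereal) set" where
  "feasible_space_time_controls U V T u0 =
     {(\<phi>0, \<phi>, \<psi>, S).
        0 < S \<and>
        (\<forall>s\<in>horizon S. 0 \<le> \<phi>0 s \<and> \<phi> s \<in> U \<and> \<psi> s \<in> V) \<and>
        1-lipschitz_on (horizon S) (\<lambda>s. (\<phi>0 s, \<phi> s)) \<and>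
        \<psi> \<in> borel_measurable (lebesgue_on (horizon S)) \<and>
        \<phi>0 0 = 0 \<and> \<phi> 0 = u0 \<and>
        (AE s in lebesgue_on (horizon S). \<exists>a b.
           (\<phi>0 has_real_derivative a) (at s) \<and> (\<phi> has_vector_derivative b) (at s) \<and>
           0 \<le> a \<and> a + norm b = 1) \<and>
        (\<phi>0 \<longlongrightarrow> T) (to_end S)}"

definition space_time_solution ::
  "(real^'n \<Rightarrow> real^'m \<Rightarrow> real^'l \<Rightarrow> real^'n) \<Rightarrow> ('m \<Rightarrow> real^'n \<Rightarrow> real^'m \<Rightarrow> real^'n) \<Rightarrow>
   real^'n \<Rightarrow> (real \<Rightarrow> real) \<Rightarrow> (real \<Rightarrow> real^'m) \<Rightarrow> (real \<Rightarrow> real^'l) \<Rightarrow> ereal \<Rightarrow>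
   (real \<Rightarrow> real^'n) \<Rightarrow> bool" where
  "space_time_solution g0 g x0 \<phi>0 \<phi> \<psi> S \<xi> \<longleftrightarrow>
     AC_loc S \<xi> \<and> \<xi> 0 = x0 \<and>
     (AE s in lebesgue_on (horizon S). \<exists>a b.
        (\<phi>0 has_real_derivative a) (at s) \<and> (\<phi> has_vector_derivative b) (at s) \<and>
        (\<xi> has_vector_derivative dynamics g0 g (\<xi> s) (\<phi> s) (\<psi> s) a b) (at s))"

text \<open>
  \<open>(\<phi>\<^sub>0,\<phi>)(S) = (T,u(T))\<close>, where for finite \<open>S\<close> the value at \<open>S\<close> is that of the extension by
  continuity, i.e. the left limit.
\<close>

definition ends_at ::
  "(real \<Rightarrow> real) \<Rightarrow> (real \<Rightarrow> 'a::topological_space) \<Rightarrow> ereal \<Rightarrow> real \<Rightarrow> 'a \<Rightarrow> bool" where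
  "ends_at \<phi>0 \<phi> S T w \<longleftrightarrow>
     (\<phi>0 \<longlongrightarrow> T) (to_end S) \<and>
     (S < \<infinity> \<longrightarrow> (\<phi> \<longlongrightarrow> w) (to_end S)) \<and>
     (S = \<infinity> \<longrightarrow> w \<in> limit_set \<infinity> \<phi>)"

definition BV_loc_graph_completion ::
  "(real^'m) set \<Rightarrow> (real^'l) set \<Rightarrow> real \<Rightarrow> real^'m \<Rightarrow> (real \<Rightarrow> real^'m) \<Rightarrow> (real \<Rightarrow> real^'l) \<Rightarrow>
   (real \<Rightarrow> real) \<Rightarrow> (real \<Rightarrow> real^'m) \<Rightarrow> (real \<Rightarrow> real^'l) \<Rightarrow> ereal \<Rightarrow> bool" where
  "BV_loc_graph_completion U V T u0 u v \<phi>0 \<phi> \<psi> S \<longleftrightarrow>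
     u ` {0..T} \<subseteq> U \<and> (\<forall>t\<in>{0..<T}. BV_on 0 t u) \<and> u 0 = u0 \<and>
     (\<phi>0, \<phi>, \<psi>, S) \<in> feasible_space_time_controls U V T u0 \<and>
     (\<forall>t\<in>{0..<T}. \<exists>s\<in>horizon S. \<phi>0 s = t \<and> \<phi> s = u t \<and> \<psi> s = v t) \<and>
     ends_at \<phi>0 \<phi> S T (u T)"

text \<open>
  For \<open>t < T\<close> the requirement \<open>\<phi>\<^sub>0(\<sigma>(t)) = t\<close> forces \<open>\<sigma>(t) < S\<close>, because
  \<open>\<phi>\<^sub>0(S) = T\<close>; hence \<open>\<sigma>(t)\<close> is required to lie in \<open>[0,S[\<close>.  A jump of \<open>\<sigma>\<close> at \<open>T\<close> is allowed.
\<close>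

definition is_clock ::
  "real \<Rightarrow> (real \<Rightarrow> 'a::topological_space) \<Rightarrow> (real \<Rightarrow> real) \<Rightarrow> (real \<Rightarrow> 'a) \<Rightarrow> ereal \<Rightarrow>
   (real \<Rightarrow> ereal) \<Rightarrow> bool" where
  "is_clock T u \<phi>0 \<phi> S \<sigma> \<longleftrightarrow>
     mono_on {0..T} \<sigma> \<and> \<sigma> 0 = 0 \<and> \<sigma> T = S \<and>
     (\<forall>t\<in>{0..<T}. 0 \<le> \<sigma> t \<and> \<sigma> t < S \<and>
        \<phi>0 (real_of_ereal (\<sigma> t)) = t \<and> \<phi> (real_of_ereal (\<sigma> t)) = u t) \<and>
     ends_at \<phi>0 \<phi> S T (u T)"

text \<open>\<open>x\<close> is the graph completion solution associated to the completion and the clock \<open>\<sigma>\<close>.\<close>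

definition associated_solution ::
  "(real^'n \<Rightarrow> real^'m \<Rightarrow> real^'l \<Rightarrow> real^'n) \<Rightarrow> ('m \<Rightarrow> real^'n \<Rightarrow> real^'m \<Rightarrow> real^'n) \<Rightarrow>
   (real^'m) set \<Rightarrow> (real^'l) set \<Rightarrow> real \<Rightarrow> real^'n \<Rightarrow> real^'m \<Rightarrow>
   (real \<Rightarrow> real^'m) \<Rightarrow> (real \<Rightarrow> real^'l) \<Rightarrow>
   (real \<Rightarrow> real) \<Rightarrow> (real \<Rightarrow> real^'m) \<Rightarrow> (real \<Rightarrow> real^'l) \<Rightarrow> ereal \<Rightarrow> (real \<Rightarrow> ereal) \<Rightarrow>
   (real \<Rightarrow> real^'n) \<Rightarrow> bool" where
  "associated_solution g0 g U V T x0 u0 u v \<phi>0 \<phi> \<psi> S \<sigma> x \<longleftrightarrow>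
     BV_loc_graph_completion U V T u0 u v \<phi>0 \<phi> \<psi> S \<and> is_clock T u \<phi>0 \<phi> S \<sigma> \<and>
     (\<exists>\<xi>. space_time_solution g0 g x0 \<phi>0 \<phi> \<psi> S \<xi> \<and>
        (S = \<infinity> \<longrightarrow> bounded (\<xi> ` horizon S)) \<and>
        (\<forall>t\<in>{0..<T}. x t = \<xi> (real_of_ereal (\<sigma> t))) \<and>
        (S < \<infinity> \<longrightarrow> (\<xi> \<longlongrightarrow> x T) (to_end S)) \<and>
        (S = \<infinity> \<longrightarrow> (x T, u T) \<in> limit_set \<infinity> (\<lambda>s. (\<xi> s, \<phi> s))))"

definition BV_loc_graph_completion_solution ::
  "(real^'n \<Rightarrow> real^'m \<Rightarrow> real^'l \<Rightarrow> real^'n) \<Rightarrow> ('m \<Rightarrow> real^'n \<Rightarrow> real^'m \<Rightarrow> real^'n) \<Rightarrow>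
   (real^'m) set \<Rightarrow> (real^'l) set \<Rightarrow> real \<Rightarrow> real^'n \<Rightarrow> real^'m \<Rightarrow>
   (real \<Rightarrow> real^'m) \<Rightarrow> (real \<Rightarrow> real^'l) \<Rightarrow> (real \<Rightarrow> real^'n) \<Rightarrow> bool" where
  "BV_loc_graph_completion_solution g0 g U V T x0 u0 u v x \<longleftrightarrow>
     (\<exists>\<phi>0 \<phi> \<psi> S \<sigma>. associated_solution g0 g U V T x0 u0 u v \<phi>0 \<phi> \<psi> S \<sigma> x)"

definition has_BV_loops :: "(real \<Rightarrow> real) \<Rightarrow> ereal \<Rightarrow> bool" where
  "has_BV_loops \<phi>0 S \<longleftrightarrow>
     S < \<infinity> \<or>
     S = \<infinity> \<and> emeasure lebesgue {s. 0 \<le> s \<and> (\<phi>0 has_real_derivative 0) (at s)} < \<infinity>"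

text \<open>
  For finite \<open>S\<close>, the completion does not stay at time \<open>T\<close> on a whole interval \<open>[s,S]\<close>, \<open>s < S\<close>;
  equivalently, every clock satisfies \<open>\<sigma>(t) \<rightarrow> S\<close> as \<open>t \<rightarrow> T-\<close>.  A loop of \<open>\<phi>\<close> performed at the
  final time can move \<open>\<xi>(S) = x(T)\<close> away from \<open>lim x(t)\<close>.
\<close>

definition no_final_loop :: "real \<Rightarrow> (real \<Rightarrow> real) \<Rightarrow> ereal \<Rightarrow> bool" where
  "no_final_loop T \<phi>0 S \<longleftrightarrow> (S < \<infinity> \<longrightarrow> (\<forall>s\<in>horizon S. \<phi>0 s < T))"

end

theory Submission
  imports Defs
begin

text \<open>
  Let \<open>t\<close> lie outside the \<open>\<phi>\<^sub>0\<close>-images of the exceptional null set and of \<open>{\<phi>\<^sub>0' = 0}\<close>, which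
  are null sets.  At \<open>t\<close> the clock has derivative \<open>1/\<phi>\<^sub>0'\<close> and the fibre of \<open>\<phi>\<^sub>0\<close> is a single
  point, so the chain rule turns the space-time equation for \<open>\<xi>\<close> into the equation for
  \<open>x = \<xi> \<circ> \<sigma>\<close>; uniqueness is a Gronwall argument.  At the final time, if \<open>S = \<infinity>\<close> and
  \<open>{\<phi>\<^sub>0' = 0}\<close> has finite measure, the intervals on which \<open>\<phi>\<^sub>0\<close> is constant shrink at infinity.
  Hence a sequence \<open>s\<^sub>j\<close> realising \<open>(x,u)(T)\<close> may be replaced by \<open>\<sigma>(\<phi>\<^sub>0(s\<^sub>j))\<close>, because
  \<open>(\<xi>,\<phi>)\<close> is Lipschitz.
\<close>

subsection \<open>Absolutely continuous functions and null sets\<close>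

text \<open>Two features of the clock shape the argument. It may jump over the loops of the
  completion, so \<open>\<xi> \<circ> \<tau>\<close> does not inherit the regularity of
  \<open>\<xi>\<close>: absolute continuity of \<open>x\<close> has to be assumed, and
  differentiation along the clock is confined to times off the images of bad parameters. These
  images are null for two different reasons: \<open>\<phi>0\<close> is Lipschitz on the exceptional
  null set, whereas its critical set may have positive measure and is handled by Sard's theorem in
  dimension one. At the final time the danger is that \<open>\<xi>\<close> is sampled in the middle
  of a loop, far from every clock value. For finite \<open>S\<close>, \<open>no_final_loop\<close>
  gives \<open>\<phi>0 s < T\<close> for all parameters, whence \<open>\<tau> t\<close> tends to
  \<open>S\<close>. For infinite \<open>S\<close> the same strict inequality comes out of the
  measure condition, since otherwise \<open>\<phi>0\<close> would be constant on a
  half-line.\<close>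

text \<open>Bridge from the indexed families of the definition to the divisions of the gauge
  integral: intervals with disjoint interiors give disjoint open intervals between
  \<open>Inf K\<close> and \<open>Sup K\<close>, and a degenerate interval contributes the empty
  set.\<close>

lemma AC_on_tagged:
  fixes f :: "real \<Rightarrow> 'a::real_normed_vector"
  assumes "AC_on a b f" "e > 0"
  shows "\<exists>d>0. \<forall>p. p tagged_partial_division_of {a..b} \<and> (\<Sum>(x,K)\<in>p. Sup K - Inf K) < d \<longrightarrow>
       (\<Sum>(x,K)\<in>p. norm (f (Sup K) - f (Inf K))) < e"
proof -
  obtain d where "d > 0" and d: "\<forall>(k::nat) c d'. (\<forall>i<k. a \<le> c i \<and> c i \<le> d' i \<and> d' i \<le> b) \<and>
      disjoint_family_on (\<lambda>i. {c i<..<d' i}) {..<k} \<and> (\<Sum>i<k. d' i - c i) < d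
      \<longrightarrow> (\<Sum>i<k. norm (f (d' i) - f (c i))) < e"
    using assms(1)[unfolded AC_on_def, rule_format, OF assms(2)] by blast
  show ?thesis
  proof (intro exI[of _ d] conjI allI impI \<open>d > 0\<close>, elim conjE)
    fix p assume p: "p tagged_partial_division_of {a..b}"
      and small: "(\<Sum>(x,K)\<in>p. Sup K - Inf K) < d"
    note pD = tagged_partial_division_ofD[OF p]
    obtain h where h: "bij_betw h {..<card p} p"
      using ex_bij_betw_nat_finite[OF pD(1)] by (auto simp: atLeast0LessThan)
    have K: "\<exists>l r. K = {l..r} \<and> l \<le> r \<and> a \<le> l \<and> r \<le> b" if xK: "(x,K) \<in> p" for x K
    proof -
      obtain l r where "K = {l..r}" using pD(4)[OF xK] by auto
      moreover have "l \<le> r" using pD(2)[OF xK] calculation by auto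
      ultimately show ?thesis using pD(3)[OF xK] by auto
    qed
    let ?c = "\<lambda>i. Inf (snd (h i))" and ?d = "\<lambda>i. Sup (snd (h i))"
    have hp: "(fst (h i), snd (h i)) \<in> p" if "i < card p" for i
      using h that by (auto simp: bij_betw_def)
    have 1: "\<forall>i<card p. a \<le> ?c i \<and> ?c i \<le> ?d i \<and> ?d i \<le> b"
    proof (intro allI impI)
      fix i assume "i < card p"
      from K[OF hp[OF this]] show "a \<le> ?c i \<and> ?c i \<le> ?d i \<and> ?d i \<le> b" by auto
    qed
    have 2: "disjoint_family_on (\<lambda>i. {?c i<..<?d i}) {..<card p}"
      unfolding disjoint_family_on_def
    proof (intro ballI impI)
      fix i j assume ij: "i \<in> {..<card p}" "j \<in> {..<card p}" "i \<noteq> j"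
      then have "h i \<noteq> h j" using h by (auto simp: bij_betw_def inj_on_def)
      then have "interior (snd (h i)) \<inter> interior (snd (h j)) = {}"
        using pD(5)[OF hp hp] ij by (metis lessThan_iff prod.collapse)
      moreover obtain l r where "snd (h i) = {l..r}" "l \<le> r" using K[OF hp] ij by blast
      moreover obtain l' r' where "snd (h j) = {l'..r'}" "l' \<le> r'" using K[OF hp] ij by blast
      ultimately show "{?c i<..<?d i} \<inter> {?c j<..<?d j} = {}" by (simp add: interior_atLeastAtMost_real)
    qed
    have reidx: "(\<Sum>(x,K)\<in>p. F K) = (\<Sum>i<card p. F (snd (h i)))" for F :: "real set \<Rightarrow> real"
      using sum.reindex_bij_betw[OF h, of "\<lambda>(x,K). F K"] by (simp add: case_prod_unfold)
    show "(\<Sum>(x,K)\<in>p. norm (f (Sup K) - f (Inf K))) < e"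
      using d[rule_format, OF conjI[OF 1 conjI[OF 2]]] small unfolding reidx by simp
  qed
qed

lemma has_vector_derivative_linear_approx:
  assumes "(f has_vector_derivative f') (at t)" "e > 0"
  shows "\<exists>r>0. \<forall>s. \<bar>s - t\<bar> < r \<longrightarrow> norm (f s - f t - (s - t) *\<^sub>R f') \<le> e * \<bar>s - t\<bar>"
  using assms unfolding has_vector_derivative_def has_derivative_at_alt real_norm_def by blast

text \<open>The straddle lemma of gauge integration: because the tag lies between the endpoints, the
  distances \<open>\<bar>l - x\<bar>\<close> and \<open>\<bar>q - x\<bar>\<close> add up to exactly
  \<open>q - l\<close>.\<close>

lemma linear_approx_straddle:
  fixes f :: "real \<Rightarrow> 'a::real_normed_vector"
  assumes "\<And>s. \<bar>s - x\<bar> < r \<Longrightarrow> norm (f s - f x - (s - x) *\<^sub>R f') \<le> e * \<bar>s - x\<bar>"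
    and "\<bar>l - x\<bar> < r" "\<bar>q - x\<bar> < r" "l \<le> x" "x \<le> q"
  shows "norm (f q - f l - (q - l) *\<^sub>R f') \<le> e * (q - l)"
proof -
  have "f q - f l - (q - l) *\<^sub>R f' = (f q - f x - (q - x) *\<^sub>R f') - (f l - f x - (l - x) *\<^sub>R f')"
    by (simp add: algebra_simps)
  then have "norm (f q - f l - (q - l) *\<^sub>R f')
      \<le> norm (f q - f x - (q - x) *\<^sub>R f') + norm (f l - f x - (l - x) *\<^sub>R f')"
    by (metis norm_triangle_ineq4)
  also have "\<dots> \<le> e * \<bar>q - x\<bar> + e * \<bar>l - x\<bar>" by (intro add_mono assms(1-3))
  also have "\<dots> = e * (q - l)" using assms by (simp add: algebra_simps)
  finally show ?thesis .
qed

text \<open>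
  A Riemann sum over a tagged division: absolute continuity controls the intervals tagged in \<open>N\<close>,
  differentiability at the tag controls the others.  The variation of \<open>w\<close> stands in for
  \<open>\<integral> |w'|\<close>, which avoids the fundamental theorem for absolutely continuous functions.
\<close>

lemma AC_norm_bound:
  fixes z :: "real \<Rightarrow> 'a::real_normed_vector" and w :: "real \<Rightarrow> 'b::real_normed_vector"
  assumes ab: "a \<le> b" and z: "AC_on a b z" and N: "negligible N" and "0 \<le> C" "0 \<le> D"
    and der: "\<And>t. t \<in> {a..b} - N \<Longrightarrow> \<exists>z' w'. (z has_vector_derivative z') (at t) \<and>
        (w has_vector_derivative w') (at t) \<and> norm z' \<le> C + D * norm w'"
    and B: "\<And>p. p tagged_division_of {a..b} \<Longrightarrow> (\<Sum>(x,K)\<in>p. norm (w (Sup K) - w (Inf K))) \<le> B"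
  shows "norm (z b - z a) \<le> C * (b - a) + D * B"
proof (rule field_le_epsilon)
  fix e :: real assume "e > 0"
  \<comment> \<open>The differentiability error will be \<open>(1 + D) * \<eta>\<close> per unit
    length, hence at most \<open>e / 2\<close> in total. The summand \<open>1\<close> keeps the
    denominator positive when \<open>a = b\<close>.\<close>
  define \<eta> where "\<eta> = e / 2 / ((1 + D) * (b - a) + 1)"
  have den: "(1 + D) * (b - a) + 1 > 0" using ab \<open>0 \<le> D\<close> by (simp add: add_nonneg_pos)
  then have "\<eta> > 0" using \<open>e > 0\<close> by (simp add: \<eta>_def)
  have \<eta>: "\<eta> * ((1 + D) * (b - a)) \<le> e / 2"
  proof -
    have "\<eta> * ((1 + D) * (b - a)) \<le> \<eta> * ((1 + D) * (b - a) + 1)" using \<open>\<eta> > 0\<close> by simp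
    also have "\<dots> = e / 2" unfolding \<eta>_def using den by (metis nonzero_eq_divide_eq less_irrefl)
    finally show ?thesis .
  qed
  obtain d where "d > 0" and d: "\<And>p. p tagged_partial_division_of {a..b} \<Longrightarrow>
      (\<Sum>(x,K)\<in>p. Sup K - Inf K) < d \<Longrightarrow> (\<Sum>(x,K)\<in>p. norm (z (Sup K) - z (Inf K))) < e / 2"
    using AC_on_tagged[OF z half_gt_zero[OF \<open>e > 0\<close>]] by blast
  \<comment> \<open>The Riemann sum of the indicator of \<open>N\<close> over a division is the
    total length of the intervals tagged in \<open>N\<close>. Its integral is 0, so a suitable gauge
    forces this length below the \<open>d\<close> of absolute continuity.\<close>
  have "((indicator N :: real \<Rightarrow> real) has_integral 0) {a..b}"
    using N unfolding negligible_def by (metis box_real(2))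
  then have "\<exists>\<gamma>. gauge \<gamma> \<and> (\<forall>p. p tagged_division_of {a..b} \<and> \<gamma> fine p \<longrightarrow>
      norm ((\<Sum>(x,K)\<in>p. measure lborel K *\<^sub>R (indicator N x :: real)) - 0) < d)"
    using \<open>d > 0\<close> unfolding has_integral_real by blast
  then obtain \<gamma> where "gauge \<gamma>" and \<gamma>: "\<forall>p. p tagged_division_of {a..b} \<and> \<gamma> fine p \<longrightarrow>
      norm ((\<Sum>(x,K)\<in>p. measure lborel K *\<^sub>R (indicator N x :: real)) - 0) < d"
    by (elim exE conjE)
  obtain z' w' where zw: "\<And>t. t \<in> {a..b} - N \<Longrightarrow> (z has_vector_derivative z' t) (at t) \<and>
        (w has_vector_derivative w' t) (at t) \<and> norm (z' t) \<le> C + D * norm (w' t)"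
    using der by metis
  \<comment> \<open>A gauge needs a positive radius at every tag, including those in
    \<open>N\<close>, where nothing is claimed and 1 is taken.\<close>
  have "\<exists>r>0. t \<in> {a..b} - N \<longrightarrow> (\<forall>s. \<bar>s - t\<bar> < r \<longrightarrow>
      norm (z s - z t - (s - t) *\<^sub>R z' t) \<le> \<eta> * \<bar>s - t\<bar> \<and>
      norm (w s - w t - (s - t) *\<^sub>R w' t) \<le> \<eta> * \<bar>s - t\<bar>)" for t
  proof (cases "t \<in> {a..b} - N")
    case True
    obtain r1 r2 where "r1 > 0" "r2 > 0"
      "\<forall>s. \<bar>s - t\<bar> < r1 \<longrightarrow> norm (z s - z t - (s - t) *\<^sub>R z' t) \<le> \<eta> * \<bar>s - t\<bar>"
      "\<forall>s. \<bar>s - t\<bar> < r2 \<longrightarrow> norm (w s - w t - (s - t) *\<^sub>R w' t) \<le> \<eta> * \<bar>s - t\<bar>"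
      using has_vector_derivative_linear_approx[of z "z' t" t \<eta>]
        has_vector_derivative_linear_approx[of w "w' t" t \<eta>] zw[OF True] \<open>\<eta> > 0\<close> by blast
    then show ?thesis by (intro exI[of _ "min r1 r2"]) auto
  qed (auto intro: exI[of _ 1])
  then obtain r where r': "\<And>t. r t > 0 \<and> (t \<in> {a..b} - N \<longrightarrow> (\<forall>s. \<bar>s - t\<bar> < r t \<longrightarrow>
      norm (z s - z t - (s - t) *\<^sub>R z' t) \<le> \<eta> * \<bar>s - t\<bar> \<and>
      norm (w s - w t - (s - t) *\<^sub>R w' t) \<le> \<eta> * \<bar>s - t\<bar>))"
    by metis
  have r: "\<And>t. r t > 0" and rz: "\<And>t s. t \<in> {a..b} - N \<Longrightarrow> \<bar>s - t\<bar> < r t \<Longrightarrow>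
      norm (z s - z t - (s - t) *\<^sub>R z' t) \<le> \<eta> * \<bar>s - t\<bar>"
    and rw: "\<And>t s. t \<in> {a..b} - N \<Longrightarrow> \<bar>s - t\<bar> < r t \<Longrightarrow>
      norm (w s - w t - (s - t) *\<^sub>R w' t) \<le> \<eta> * \<bar>s - t\<bar>"
    using r' by blast+
  have "gauge (\<lambda>t. \<gamma> t \<inter> ball t (r t))"
    using \<open>gauge \<gamma>\<close> r by (intro gauge_Int gauge_ball_dependent) auto
  then obtain p where p: "p tagged_division_of {a..b}" and fine: "(\<lambda>t. \<gamma> t \<inter> ball t (r t)) fine p"
    using fine_division_exists_real by blast
  note pD = tagged_division_ofD[OF p]
  have K: "\<exists>l r. K = {l..r} \<and> l \<le> x \<and> x \<le> r \<and> a \<le> l \<and> r \<le> b" if xK: "(x,K) \<in> p" for x K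
  proof -
    obtain l r where "K = {l..r}" using pD(4)[OF xK] by auto
    moreover have "l \<le> x" "x \<le> r" using pD(2)[OF xK] calculation by auto
    ultimately show ?thesis using pD(3)[OF xK] by auto
  qed
  define pN where "pN = {q \<in> p. fst q \<in> N}"
  define pG where "pG = {q \<in> p. fst q \<notin> N}"
  have split: "(\<Sum>q\<in>p. F q) = (\<Sum>q\<in>pN. F q) + (\<Sum>q\<in>pG. F q)" for F :: "real \<times> real set \<Rightarrow> real"
  proof -
    have "p = pN \<union> pG" "pN \<inter> pG = {}" "finite pN" "finite pG" using pD(1) by (auto simp: pN_def pG_def)
    then show ?thesis by (metis sum.union_disjoint)
  qed
  have bad: "(\<Sum>(x,K)\<in>pN. norm (z (Sup K) - z (Inf K))) < e / 2"
  proof (rule d)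
    show "pN tagged_partial_division_of {a..b}"
      using p unfolding tagged_division_of_def by (auto simp: pN_def intro: tagged_partial_division_subset)
    have "(\<Sum>(x,K)\<in>pN. Sup K - Inf K) = (\<Sum>(x,K)\<in>pN. measure lborel K *\<^sub>R (indicator N x :: real))"
      by (rule sum.cong) (use K in \<open>fastforce simp: pN_def\<close>)+
    also have "\<dots> = (\<Sum>(x,K)\<in>p. measure lborel K *\<^sub>R (indicator N x :: real))"
      by (rule sum.mono_neutral_left) (use pD(1) in \<open>auto simp: pN_def indicator_def\<close>)
    also have "\<dots> < d" using \<gamma>[rule_format, OF conjI[OF p]] fine by (simp add: fine_Int)
    finally show "(\<Sum>(x,K)\<in>pN. Sup K - Inf K) < d" .
  qed
  \<comment> \<open>One \<open>\<eta>\<close> is the error of \<open>z\<close>. The term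
    \<open>D * \<eta>\<close> is the price of replacing \<open>(q - l) * norm (w' x)\<close> by the
    increment of \<open>w\<close>.\<close>
  have good: "norm (z (Sup K) - z (Inf K)) \<le>
      (C + (1 + D) * \<eta>) * (Sup K - Inf K) + D * norm (w (Sup K) - w (Inf K))" if "(x,K) \<in> pG" for x K
  proof -
    have xp: "(x,K) \<in> p" "x \<notin> N" using that by (auto simp: pG_def)
    obtain l q where lq: "K = {l..q}" "l \<le> x" "x \<le> q" "a \<le> l" "q \<le> b" using K[OF xp(1)] by blast
    then have x: "x \<in> {a..b} - N" using xp by auto
    have "K \<subseteq> ball x (r x)" using fine xp by (auto simp: fine_def)
    then have "l \<in> ball x (r x)" "q \<in> ball x (r x)" using lq
      by (metis atLeastAtMost_iff order.refl order.trans subsetD)+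
    then have near: "\<bar>l - x\<bar> < r x" "\<bar>q - x\<bar> < r x" by (auto simp: dist_real_def)
    have S: "Sup K = q" "Inf K = l" using lq by auto
    have z: "norm (z q - z l) \<le> (q - l) * norm (z' x) + \<eta> * (q - l)"
      using linear_approx_straddle[of x "r x" z "z' x", OF rz[OF x] near lq(2,3)]
        norm_triangle_sub[of "z q - z l" "(q - l) *\<^sub>R z' x"] lq by simp
    have w: "(q - l) * norm (w' x) \<le> norm (w q - w l) + \<eta> * (q - l)"
      using linear_approx_straddle[of x "r x" w "w' x", OF rw[OF x] near lq(2,3)]
        norm_triangle_sub[of "(q - l) *\<^sub>R w' x" "w q - w l"] lq
      by (simp add: norm_minus_commute)
    have "(q - l) * norm (z' x) \<le> (q - l) * (C + D * norm (w' x))"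
      using zw[OF x] lq by (intro mult_left_mono) auto
    also have "\<dots> = C * (q - l) + D * ((q - l) * norm (w' x))" by (simp add: algebra_simps)
    also have "\<dots> \<le> C * (q - l) + D * (norm (w q - w l) + \<eta> * (q - l))"
      using w \<open>0 \<le> D\<close> by (intro add_left_mono mult_left_mono) auto
    finally show ?thesis unfolding S using z by (simp add: algebra_simps)
  qed
  have len: "(\<Sum>(x,K)\<in>p. Sup K - Inf K) = b - a"
    using additive_tagged_division_1[OF ab p, of "\<lambda>x. x"] by simp
  have "norm (z b - z a) = norm (\<Sum>(x,K)\<in>p. z (Sup K) - z (Inf K))"
    using additive_tagged_division_1[OF ab p, of z] by simp
  also have "\<dots> \<le> (\<Sum>(x,K)\<in>p. norm (z (Sup K) - z (Inf K)))"
    by (rule order_trans[OF norm_sum]) (simp add: case_prod_unfold)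
  also have "\<dots> \<le> e / 2 + (\<Sum>(x,K)\<in>pG. norm (z (Sup K) - z (Inf K)))"
    using bad unfolding split by simp
  also have "(\<Sum>(x,K)\<in>pG. norm (z (Sup K) - z (Inf K)))
      \<le> (\<Sum>(x,K)\<in>pG. (C + (1 + D) * \<eta>) * (Sup K - Inf K) + D * norm (w (Sup K) - w (Inf K)))"
    using good by (intro sum_mono) auto
  \<comment> \<open>The nonnegative terms tagged in \<open>N\<close> are added back, because the
    hypothesis on \<open>B\<close> and the telescoping of lengths speak of full divisions of
    \<open>{a..b}\<close>.\<close>
  also have "\<dots> \<le> (\<Sum>(x,K)\<in>p. (C + (1 + D) * \<eta>) * (Sup K - Inf K) + D * norm (w (Sup K) - w (Inf K)))"
  proof (rule sum_mono2)
    fix q assume "q \<in> p - pG"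
    then obtain x K where q: "q = (x,K)" "(x,K) \<in> p" by (cases q) auto
    then have "Inf K \<le> Sup K" using K by fastforce
    then show "0 \<le> (case q of (x,K) \<Rightarrow> (C + (1 + D) * \<eta>) * (Sup K - Inf K) + D * norm (w (Sup K) - w (Inf K)))"
      using q \<open>0 \<le> C\<close> \<open>0 \<le> D\<close> \<open>\<eta> > 0\<close> by simp
  qed (use pD(1) in \<open>auto simp: pG_def\<close>)
  also have "\<dots> = (C + (1 + D) * \<eta>) * (\<Sum>(x,K)\<in>p. Sup K - Inf K) + D * (\<Sum>(x,K)\<in>p. norm (w (Sup K) - w (Inf K)))"
    by (simp add: sum.distrib sum_distrib_left case_prod_unfold)
  also have "\<dots> \<le> (C + (1 + D) * \<eta>) * (b - a) + D * B"
    unfolding len using B[OF p] \<open>0 \<le> D\<close> by (intro add_left_mono mult_left_mono) auto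
  also have "\<dots> = C * (b - a) + \<eta> * ((1 + D) * (b - a)) + D * B" by (simp add: algebra_simps)
  finally show "norm (z b - z a) \<le> C * (b - a) + D * B + e" using \<eta> by simp
qed

text \<open>One-dimensional Sard theorem. Since \<open>baby_Sard\<close> concerns maps between
  Cartesian powers, \<open>f\<close> is conjugated with the identification of \<open>real\<close>
  and \<open>real^1\<close>; its derivative there is the zero map, of rank 0.\<close>

lemma negligible_image_deriv_0:
  fixes f :: "real \<Rightarrow> real"
  assumes "\<And>s. s \<in> S \<Longrightarrow> (f has_real_derivative 0) (at s)"
  shows "negligible (f ` S)"
proof -
  let ?g = "\<lambda>x::real^1. vec (f (x $ 1)) :: real^1"
  have "negligible (?g ` {x. x $ 1 \<in> S})"
  proof (rule baby_Sard)
    show "(?g has_derivative (\<lambda>_. 0)) (at x within {x. x $ 1 \<in> S})" if "x \<in> {x. x $ 1 \<in> S}" for x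
    proof -
      have "(f has_derivative (\<lambda>_. 0)) (at (x $ 1))"
        using assms[of "x $ 1"] that by (simp add: has_field_derivative_def lambda_zero)
      from has_derivative_compose[OF bounded_linear_imp_has_derivative[OF bounded_linear_vec_nth] this]
      have "((\<lambda>x::real^1. f (x $ 1)) has_derivative (\<lambda>_. 0)) (at x)" .
      moreover have "bounded_linear (vec :: real \<Rightarrow> real^1)"
        by (intro linear_conv_bounded_linear[THEN iffD1] linearI) (simp_all add: vec_eq_iff)
      ultimately have "(?g has_derivative (\<lambda>h. vec 0)) (at x)"
        using has_derivative_compose bounded_linear_imp_has_derivative by blast
      then show ?thesis by (metis has_derivative_at_withinI vec_0)
    qed
    show "rank (matrix (\<lambda>_::real^1. 0::real^1)) < CARD(1)"  
    proof -
      have "matrix (\<lambda>_::real^1. 0::real^1) = 0" by (simp add: matrix_def vec_eq_iff)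
      then show ?thesis by (simp add: rank_0)
    qed
  qed auto
  \<comment> \<open>The coordinate map back to \<open>real\<close> is 1-Lipschitz, so it preserves
    null sets.\<close>
  then have "negligible ((\<lambda>x. x $ 1) ` ?g ` {x. x $ 1 \<in> S})"
  proof (rule negligible_locally_Lipschitz_image[rotated])
    fix x :: "real^1"
    have "norm (y $ 1 - x $ 1) \<le> 1 * norm (y - x)" for y :: "real^1"
      using component_le_norm_cart[of "y - x" 1] by simp
    then show "\<exists>T B. open T \<and> x \<in> T \<and>
        (\<forall>y\<in>?g ` {x. x $ 1 \<in> S} \<inter> T. norm (y $ 1 - x $ 1) \<le> B * norm (y - x))"
      by (intro exI[of _ UNIV] exI[of _ "1::real"]) simp
  qed simp
  also have "(\<lambda>x. x $ 1) ` ?g ` {x. x $ 1 \<in> S} = f ` S"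
    by (auto simp: image_iff) (metis vec_component)
  finally show ?thesis .
qed

section \<open>Calculus of absolutely continuous maps\<close>

lemma AC_on_subset: "AC_on a b f \<Longrightarrow> a \<le> c \<Longrightarrow> d \<le> b \<Longrightarrow> AC_on c d f"
  unfolding AC_on_def by (meson order_trans)

lemma AC_on_lipschitz:
  fixes f :: "real \<Rightarrow> 'a::real_normed_vector"
  assumes "L-lipschitz_on {a..b} f"
  shows "AC_on a b f"
  unfolding AC_on_def
proof (intro allI impI)
  fix e :: real assume "e > 0"
  have L: "L \<ge> 0" using assms by (rule lipschitz_on_nonneg)
  show "\<exists>\<delta>>0. \<forall>(k::nat) c d. (\<forall>i<k. a \<le> c i \<and> c i \<le> d i \<and> d i \<le> b) \<and>
      disjoint_family_on (\<lambda>i. {c i<..<d i}) {..<k} \<and> (\<Sum>i<k. d i - c i) < \<delta> \<longrightarrow>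
      (\<Sum>i<k. norm (f (d i) - f (c i))) < e"
  proof (intro exI[of _ "e / (L + 1)"] conjI allI impI)
    show "e / (L + 1) > 0" using \<open>e > 0\<close> L by simp
    fix k :: nat and c d :: "nat \<Rightarrow> real"
    assume "(\<forall>i<k. a \<le> c i \<and> c i \<le> d i \<and> d i \<le> b) \<and>
      disjoint_family_on (\<lambda>i. {c i<..<d i}) {..<k} \<and> (\<Sum>i<k. d i - c i) < e / (L + 1)"
    then have cd: "\<forall>i<k. a \<le> c i \<and> c i \<le> d i \<and> d i \<le> b"
      and s: "(\<Sum>i<k. d i - c i) < e / (L + 1)" by auto
    have "(\<Sum>i<k. norm (f (d i) - f (c i))) \<le> (\<Sum>i<k. (L + 1) * (d i - c i))"
    proof (rule sum_mono)
      fix i assume "i \<in> {..<k}"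
      with cd have i: "a \<le> c i" "c i \<le> d i" "d i \<le> b" by auto
      then have "norm (f (d i) - f (c i)) \<le> L * norm (d i - c i)"
        by (intro lipschitz_on_normD[OF assms]) auto
      then show "norm (f (d i) - f (c i)) \<le> (L + 1) * (d i - c i)"
        using i by (simp add: algebra_simps)
    qed
    also have "\<dots> = (L + 1) * (\<Sum>i<k. d i - c i)" by (simp add: sum_distrib_left)
    also have "\<dots> < (L + 1) * (e / (L + 1))" using s L by (intro mult_strict_left_mono) auto
    also have "\<dots> = e" using L by simp
    finally show "(\<Sum>i<k. norm (f (d i) - f (c i))) < e" .
  qed
qed

lemma AC_on_diff:
  fixes f g :: "real \<Rightarrow> 'a::real_normed_vector"
  assumes "AC_on a b f" "AC_on a b g"
  shows "AC_on a b (\<lambda>t. f t - g t)"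
  unfolding AC_on_def
proof (intro allI impI)
  fix e :: real assume "e > 0"
  then have "e / 2 > 0" by simp
  obtain d1 where d1: "d1 > 0" "\<forall>(k::nat) c d. (\<forall>i<k. a \<le> c i \<and> c i \<le> d i \<and> d i \<le> b) \<and>
      disjoint_family_on (\<lambda>i. {c i<..<d i}) {..<k} \<and> (\<Sum>i<k. d i - c i) < d1 \<longrightarrow>
      (\<Sum>i<k. norm (f (d i) - f (c i))) < e / 2"
    using assms(1)[unfolded AC_on_def, rule_format, OF \<open>e / 2 > 0\<close>] by blast
  obtain d2 where d2: "d2 > 0" "\<forall>(k::nat) c d. (\<forall>i<k. a \<le> c i \<and> c i \<le> d i \<and> d i \<le> b) \<and>
      disjoint_family_on (\<lambda>i. {c i<..<d i}) {..<k} \<and> (\<Sum>i<k. d i - c i) < d2 \<longrightarrow>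
      (\<Sum>i<k. norm (g (d i) - g (c i))) < e / 2"
    using assms(2)[unfolded AC_on_def, rule_format, OF \<open>e / 2 > 0\<close>] by blast
  show "\<exists>\<delta>>0. \<forall>(k::nat) c d. (\<forall>i<k. a \<le> c i \<and> c i \<le> d i \<and> d i \<le> b) \<and>
      disjoint_family_on (\<lambda>i. {c i<..<d i}) {..<k} \<and> (\<Sum>i<k. d i - c i) < \<delta> \<longrightarrow>
      (\<Sum>i<k. norm (f (d i) - g (d i) - (f (c i) - g (c i)))) < e"
  proof (intro exI[of _ "min d1 d2"] conjI allI impI)
    show "min d1 d2 > 0" using d1 d2 by simp
    fix k :: nat and c d :: "nat \<Rightarrow> real"
    assume "(\<forall>i<k. a \<le> c i \<and> c i \<le> d i \<and> d i \<le> b) \<and>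
      disjoint_family_on (\<lambda>i. {c i<..<d i}) {..<k} \<and> (\<Sum>i<k. d i - c i) < min d1 d2"
    then have cd: "\<forall>i<k. a \<le> c i \<and> c i \<le> d i \<and> d i \<le> b"
      "disjoint_family_on (\<lambda>i. {c i<..<d i}) {..<k}"
      and s: "(\<Sum>i<k. d i - c i) < min d1 d2" by auto
    have "(\<Sum>i<k. norm (f (d i) - g (d i) - (f (c i) - g (c i))))
        \<le> (\<Sum>i<k. norm (f (d i) - f (c i)) + norm (g (d i) - g (c i)))"
    proof (rule sum_mono)
      fix i
      have "f (d i) - g (d i) - (f (c i) - g (c i)) = (f (d i) - f (c i)) - (g (d i) - g (c i))" by simp
      then show "norm (f (d i) - g (d i) - (f (c i) - g (c i)))
          \<le> norm (f (d i) - f (c i)) + norm (g (d i) - g (c i))" by (metis norm_triangle_ineq4)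
    qed
    also have "\<dots> < e / 2 + e / 2"
      unfolding sum.distrib using s cd by (intro add_strict_mono d1(2)[rule_format] d2(2)[rule_format]) auto
    finally show "(\<Sum>i<k. norm (f (d i) - g (d i) - (f (c i) - g (c i)))) < e" by simp
  qed
qed

lemma AC_on_small_increment:
  fixes f :: "real \<Rightarrow> 'a::real_normed_vector"
  assumes "AC_on a b f" "e > 0"
  shows "\<exists>d>0. \<forall>s t. a \<le> s \<and> s \<le> t \<and> t \<le> b \<and> t - s < d \<longrightarrow> norm (f t - f s) < e"
proof -
  obtain d where d: "d > 0" "\<forall>(k::nat) c d'. (\<forall>i<k. a \<le> c i \<and> c i \<le> d' i \<and> d' i \<le> b) \<and>
      disjoint_family_on (\<lambda>i. {c i<..<d' i}) {..<k} \<and> (\<Sum>i<k. d' i - c i) < d \<longrightarrow>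
      (\<Sum>i<k. norm (f (d' i) - f (c i))) < e"
    using assms(1)[unfolded AC_on_def, rule_format, OF assms(2)] by blast
  show ?thesis
  proof (intro exI[of _ d] conjI allI impI d(1))
    fix s t assume "a \<le> s \<and> s \<le> t \<and> t \<le> b \<and> t - s < d"
    then show "norm (f t - f s) < e"
      using d(2)[rule_format, of "Suc 0" "\<lambda>_. s" "\<lambda>_. t"] by (simp add: disjoint_family_on_def)
  qed
qed

lemma AC_on_imp_continuous_on:
  fixes f :: "real \<Rightarrow> 'a::real_normed_vector"
  assumes "AC_on a b f"
  shows "continuous_on {a..b} f"
  unfolding continuous_on_iff
proof (intro ballI allI impI)
  fix t and e :: real assume t: "t \<in> {a..b}" and "e > 0"
  obtain d where "d > 0"
    and d: "\<forall>s t. a \<le> s \<and> s \<le> t \<and> t \<le> b \<and> t - s < d \<longrightarrow> norm (f t - f s) < e"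
    using AC_on_small_increment[OF assms \<open>e > 0\<close>] by blast
  have "dist (f s) (f t) < e" if "s \<in> {a..b}" "dist s t < d" for s
  proof (cases "s \<le> t")
    case True then show ?thesis using d[rule_format, of s t] that t
      by (simp add: dist_real_def dist_norm norm_minus_commute)
  next
    case False then show ?thesis using d[rule_format, of t s] that t
      by (simp add: dist_real_def dist_norm)
  qed
  then show "\<exists>d>0. \<forall>s\<in>{a..b}. dist s t < d \<longrightarrow> dist (f s) (f t) < e" using \<open>d > 0\<close> by blast
qed

text \<open>Supplies the bound \<open>B\<close> of \<open>AC_norm_bound\<close>: the intervals of a
  division of \<open>{s..t}\<close> have total length \<open>t - s\<close>, so one \<open>d\<close>
  works for all divisions of all short subintervals.\<close>

lemma AC_on_small_variation:
  fixes f :: "real \<Rightarrow> 'a::real_normed_vector"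
  assumes "AC_on a b f" "e > 0"
  shows "\<exists>d>0. \<forall>s t p. a \<le> s \<and> s \<le> t \<and> t \<le> b \<and> t - s < d \<and> p tagged_division_of {s..t} \<longrightarrow>
     (\<Sum>(x,K)\<in>p. norm (f (Sup K) - f (Inf K))) < e"
proof -
  obtain d where "d > 0" and d: "\<And>p. p tagged_partial_division_of {a..b} \<Longrightarrow>
      (\<Sum>(x,K)\<in>p. Sup K - Inf K) < d \<Longrightarrow> (\<Sum>(x,K)\<in>p. norm (f (Sup K) - f (Inf K))) < e"
    using AC_on_tagged[OF assms] by blast
  show ?thesis
  proof (intro exI[of _ d] conjI allI impI \<open>d > 0\<close>, elim conjE, rule d)
    fix s t p assume *: "a \<le> s" "s \<le> t" "t \<le> b" "t - s < d" "p tagged_division_of {s..t}"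
    then show "p tagged_partial_division_of {a..b}"
      unfolding tagged_division_of_def tagged_partial_division_of_def by fastforce
    show "(\<Sum>(x,K)\<in>p. Sup K - Inf K) < d"
      using additive_tagged_division_1[OF *(2,5), of "\<lambda>x. x"] * by simp
  qed
qed

text \<open>The mean value inequality with a derivative known only off a null set; the constant map
  in the place of \<open>w\<close> removes the variation term from
  \<open>AC_norm_bound\<close>.\<close>

lemma AC_on_deriv_bound:
  fixes z :: "real \<Rightarrow> 'a::real_normed_vector"
  assumes "a \<le> b" "AC_on a b z" "negligible N" "0 \<le> C"
    and "\<And>t. t \<in> {a..b} - N \<Longrightarrow> \<exists>z'. (z has_vector_derivative z') (at t) \<and> norm z' \<le> C"
  shows "norm (z b - z a) \<le> C * (b - a)"
proof -
  have "norm (z b - z a) \<le> C * (b - a) + 0 * 0"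
  proof (rule AC_norm_bound[OF assms(1-4), where w = "\<lambda>_. 0::real"])
    fix t assume "t \<in> {a..b} - N"
    from assms(5)[OF this] obtain z' where "(z has_vector_derivative z') (at t)" "norm z' \<le> C" by blast
    moreover have "((\<lambda>_. 0::real) has_vector_derivative 0) (at t)" by simp
    ultimately show "\<exists>z' w'. (z has_vector_derivative z') (at t) \<and>
        ((\<lambda>_. 0::real) has_vector_derivative w') (at t) \<and> norm z' \<le> C + 0 * norm w'"
      by (intro exI[of _ z'] exI[of _ "0::real"]) simp
  qed auto
  then show ?thesis by simp
qed

lemma AE_lebesgue_on_iff_negligible:
  assumes "S \<in> sets lebesgue"
  shows "(AE x in lebesgue_on S. P x) \<longleftrightarrow> (\<exists>N. negligible N \<and> (\<forall>x\<in>S - N. P x))"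
proof -
  have "(AE x in lebesgue_on S. P x) \<longleftrightarrow> (AE x in lebesgue. x \<in> S \<longrightarrow> P x)"
    using assms by (subst AE_restrict_space_iff) auto
  then show ?thesis unfolding eventually_ae_filter_negligible by blast
qed

text \<open>An absorption argument replaces the exponential: on a short interval the maximum
  \<open>m\<close> of \<open>norm (z t)\<close> satisfies \<open>m \<le> m/4 + m/4\<close>, the
  quarters coming from \<open>K1\<close> times the length and from \<open>K2\<close> times the
  variation of \<open>w\<close>. Hence \<open>m = 0\<close>.\<close>

lemma AC_gronwall_local:
  fixes z :: "real \<Rightarrow> 'a::real_normed_vector" and w :: "real \<Rightarrow> 'b::real_normed_vector"
  assumes ab: "a < b" and z: "AC_on a b z" and w: "AC_on a b w" and "negligible N"
    and K: "0 \<le> K1" "0 \<le> K2" and za: "z a = 0"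
    and der: "\<And>t. t \<in> {a..b} - N \<Longrightarrow> \<exists>z' w'. (z has_vector_derivative z') (at t) \<and>
        (w has_vector_derivative w') (at t) \<and> norm z' \<le> (K1 + K2 * norm w') * norm (z t)"
  shows "\<exists>c. a < c \<and> c \<le> b \<and> (\<forall>t\<in>{a..c}. z t = 0)"
proof -
  define e where "e = 1 / (4 * (K2 + 1))"
  have "e > 0" and e: "K2 * e \<le> 1/4" using K by (auto simp: e_def field_simps)
  obtain d where "d > 0" and d: "\<And>s t p. \<lbrakk>a \<le> s; s \<le> t; t \<le> b; t - s < d; p tagged_division_of {s..t}\<rbrakk>
      \<Longrightarrow> (\<Sum>(x,K)\<in>p. norm (w (Sup K) - w (Inf K))) < e"
    using AC_on_small_variation[OF w \<open>e > 0\<close>] by blast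
  define h where "h = 1 / (4 * (K1 + 1))"
  have "h > 0" and h: "K1 * h \<le> 1/4" using K by (auto simp: h_def field_simps)
  \<comment> \<open>The half of \<open>d\<close> makes \<open>c - a < d\<close> strict, as the bound
    on the variation of \<open>w\<close> requires.\<close>
  define c where "c = min b (a + min (d/2) h)"
  have c: "a < c" "c \<le> b" "c - a < d" "c - a \<le> h" using ab \<open>d > 0\<close> \<open>h > 0\<close> by (auto simp: c_def)
  have "continuous_on {a..c} (\<lambda>t. norm (z t))"
    using AC_on_imp_continuous_on[OF AC_on_subset[OF z order_refl c(2)]] by (intro continuous_intros)
  then obtain \<tau> where \<tau>: "\<tau> \<in> {a..c}" and max: "\<And>t. t \<in> {a..c} \<Longrightarrow> norm (z t) \<le> norm (z \<tau>)"
    using continuous_attains_sup[of "{a..c}"] c(1) by (metis atLeastAtMost_iff compact_Icc empty_iff less_imp_le order_refl)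
  let ?m = "norm (z \<tau>)"
  \<comment> \<open>The estimate is made only up to the point \<open>\<tau>\<close> where the
    maximum is attained, so that its left side is the maximum itself.\<close>
  have "norm (z \<tau> - z a) \<le> (K1 * ?m) * (\<tau> - a) + (K2 * ?m) * e"
  proof (rule AC_norm_bound[where w = w and N = N])
    show "AC_on a \<tau> z" using AC_on_subset[OF z] \<tau> c by auto
    show "\<exists>z' w'. (z has_vector_derivative z') (at t) \<and> (w has_vector_derivative w') (at t) \<and>
        norm z' \<le> K1 * ?m + K2 * ?m * norm w'" if t: "t \<in> {a..\<tau>} - N" for t
    proof -
      have "t \<in> {a..b} - N" using t \<tau> c by auto
      from der[OF this] obtain z' w' where zw: "(z has_vector_derivative z') (at t)"
        "(w has_vector_derivative w') (at t)" "norm z' \<le> (K1 + K2 * norm w') * norm (z t)" by blast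
      have "(K1 + K2 * norm w') * norm (z t) \<le> (K1 + K2 * norm w') * ?m"
        using max[of t] t \<tau> K by (intro mult_left_mono) auto
      then have "norm z' \<le> K1 * ?m + K2 * ?m * norm w'" using zw(3) by (simp add: algebra_simps)
      with zw(1,2) show ?thesis by blast
    qed
    show "(\<Sum>(x,K)\<in>p. norm (w (Sup K) - w (Inf K))) \<le> e" if "p tagged_division_of {a..\<tau>}" for p
      using d[of a \<tau> p] that \<tau> c by auto
  qed (use \<tau> K assms in auto)
  also have "\<dots> \<le> ?m * (K1 * h) + ?m * (K2 * e)"
  proof -
    have "(K1 * ?m) * (\<tau> - a) \<le> (K1 * ?m) * h" using \<tau> c K by (intro mult_left_mono) auto
    then show ?thesis by (simp add: algebra_simps)
  qed
  also have "\<dots> \<le> ?m * (1/4) + ?m * (1/4)" using h e by (intro add_mono mult_left_mono) auto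
  finally have "?m = 0" using za by simp
  then have "z t = 0" if "t \<in> {a..c}" for t using max[OF that] by simp
  then show ?thesis using c by blast
qed

subsection \<open>Uniqueness of trajectories\<close>

lemma horizon_sets_lebesgue: "horizon S \<in> sets lebesgue"
proof -
  have "horizon S = (case S of ereal r \<Rightarrow> {0..<r} | PInfty \<Rightarrow> {0..} | MInfty \<Rightarrow> {})"
    by (cases S) (auto simp: horizon_def)
  then show ?thesis by (cases S) auto
qed

lemma mem_horizon_ereal: "t \<in> horizon (ereal T) \<longleftrightarrow> 0 \<le> t \<and> t < T"
  by (simp add: horizon_def)

lemma horizon_downward_closed: "s \<in> horizon S \<Longrightarrow> 0 \<le> r \<Longrightarrow> r \<le> s \<Longrightarrow> r \<in> horizon S"
  unfolding horizon_def by (cases S) auto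

lemma horizon_no_max: "s \<in> horizon S \<Longrightarrow> \<exists>r>s. r \<in> horizon S"
proof -
  assume s: "s \<in> horizon S"
  show ?thesis
  proof (cases S)
    case (real r)
    then have "0 \<le> s" "s < r" using s by (auto simp: horizon_def)
    then show ?thesis using real by (intro exI[of _ "(s + r) / 2"]) (simp add: horizon_def)
  next
    case PInf
    then show ?thesis using s by (intro exI[of _ "s + 1"]) (simp add: horizon_def)
  qed (use s in \<open>simp add: horizon_def\<close>)
qed

text \<open>Both states are driven by the same \<open>w\<close>, \<open>v\<close> and
  \<open>b\<close>, so only the dependence on the state matters. The constant is affine in
  \<open>norm b\<close>, which is the form that \<open>AC_gronwall_local\<close> accepts when
  \<open>b\<close> is the derivative of \<open>u\<close>. A common radius exists because there are
  finitely many fields.\<close>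

lemma dynamics_locally_lipschitz:
  fixes g0 :: "real^'n \<Rightarrow> real^'m \<Rightarrow> real^'l \<Rightarrow> real^'n"
    and g :: "'m \<Rightarrow> real^'n \<Rightarrow> real^'m \<Rightarrow> real^'n"
  assumes g0: "locally_lipschitz_uniformly_on (UNIV \<times> U) V (\<lambda>v (x, u). g0 x u v)"
    and g: "\<And>i. locally_lipschitz_uniformly_on (UNIV \<times> U) {i} (\<lambda>i (x, u). g i x u)"
    and "w0 \<in> U"
  shows "\<exists>r K1 K2. 0 < r \<and> 0 \<le> K1 \<and> 0 \<le> K2 \<and> (\<forall>x y w v b. w \<in> U \<and> v \<in> V \<and>
      dist (x0, w0) (x, w) \<le> r \<and> dist (x0, w0) (y, w) \<le> r \<longrightarrow>
      norm (dynamics g0 g x w v 1 b - dynamics g0 g y w v 1 b) \<le> (K1 + K2 * norm b) * norm (x - y))"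
proof -
  have z: "(x0, w0) \<in> UNIV \<times> U" using \<open>w0 \<in> U\<close> by simp
  obtain r0 L0 where "r0 > 0" and L0: "\<And>v. v \<in> V \<Longrightarrow>
      L0-lipschitz_on (cball (x0, w0) r0 \<inter> UNIV \<times> U) (\<lambda>(x, u). g0 x u v)"
    using g0[unfolded locally_lipschitz_uniformly_on_def, rule_format, OF z] by blast
  have "\<exists>r L. r > 0 \<and> L-lipschitz_on (cball (x0, w0) r \<inter> UNIV \<times> U) (\<lambda>(x, u). g i x u)" for i
    using g[of i, unfolded locally_lipschitz_uniformly_on_def, rule_format, OF z] by blast
  then obtain R L where R: "\<And>i. R i > 0"
    and L: "\<And>i. (L i)-lipschitz_on (cball (x0, w0) (R i) \<inter> UNIV \<times> U) (\<lambda>(x, u). g i x u)"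
    by metis
  define r where "r = min r0 (Min (range R))"
  have r: "r > 0" "r \<le> r0" "\<And>i. r \<le> R i"
    using \<open>r0 > 0\<close> R by (auto simp: r_def min.coboundedI2)
  have Lnn: "0 \<le> L i" for i using L lipschitz_on_nonneg by blast
  \<comment> \<open>The absolute value is taken because \<open>L0\<close> is known to be nonnegative
    only once some \<open>v\<close> in \<open>V\<close> is given.\<close>
  have "norm (dynamics g0 g x w v 1 b - dynamics g0 g y w v 1 b) \<le> (\<bar>L0\<bar> + (\<Sum>i\<in>UNIV. L i) * norm b) * norm (x - y)"
    if "w \<in> U" "v \<in> V" and d: "dist (x0, w0) (x, w) \<le> r" "dist (x0, w0) (y, w) \<le> r" for x y w v b
  proof -
    have nxy: "norm ((x, w) - (y, w)) = norm (x - y)" by simp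
    have 0: "norm (g0 x w v - g0 y w v) \<le> \<bar>L0\<bar> * norm (x - y)"
    proof -
      have "norm (g0 x w v - g0 y w v) \<le> L0 * norm (x - y)"
        using lipschitz_on_normD[OF L0[OF \<open>v \<in> V\<close>], of "(x, w)" "(y, w)"] d r \<open>w \<in> U\<close> nxy by auto
      also have "\<dots> \<le> \<bar>L0\<bar> * norm (x - y)" by (intro mult_right_mono) auto
      finally show ?thesis .
    qed
    have i: "norm ((b $ i) *\<^sub>R g i x w - (b $ i) *\<^sub>R g i y w) \<le> norm b * (L i * norm (x - y))" for i
    proof -
      have "norm (g i x w - g i y w) \<le> L i * norm (x - y)"
        using lipschitz_on_normD[OF L[of i], of "(x, w)" "(y, w)"] d r(3)[of i] \<open>w \<in> U\<close> nxy by auto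
      then have "\<bar>b $ i\<bar> * norm (g i x w - g i y w) \<le> norm b * (L i * norm (x - y))"
        by (intro mult_mono) (auto simp: component_le_norm_cart)
      then show ?thesis by (simp flip: scaleR_diff_right)
    qed
    have "dynamics g0 g x w v 1 b - dynamics g0 g y w v 1 b =
        (g0 x w v - g0 y w v) + (\<Sum>i\<in>UNIV. (b $ i) *\<^sub>R g i x w - (b $ i) *\<^sub>R g i y w)"
      by (simp add: dynamics_def sum_subtractf)
    also have "norm \<dots> \<le> norm (g0 x w v - g0 y w v) + norm (\<Sum>i\<in>UNIV. (b $ i) *\<^sub>R g i x w - (b $ i) *\<^sub>R g i y w)"
      by (rule norm_triangle_ineq)
    also have "\<dots> \<le> \<bar>L0\<bar> * norm (x - y) + (\<Sum>i\<in>UNIV. norm b * (L i * norm (x - y)))"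
      using 0 i by (intro add_mono sum_norm_le)
    also have "\<dots> = (\<bar>L0\<bar> + (\<Sum>i\<in>UNIV. L i) * norm b) * norm (x - y)"
      by (simp add: sum_distrib_left sum_distrib_right algebra_simps)
    finally show ?thesis .
  qed
  then show ?thesis
    using r(1) Lnn by (intro exI[of _ r] exI[of _ "\<bar>L0\<bar>"] exI[of _ "\<Sum>i\<in>UNIV. L i"]) (auto intro: sum_nonneg)
qed

text \<open>Continuation from the infimum \<open>t0\<close> of the times of disagreement: the
  solutions agree at \<open>t0\<close>, and the local Gronwall estimate extends the agreement beyond
  it.\<close>

theorem caratheodory_solution_unique:
  fixes g0 :: "real^'n \<Rightarrow> real^'m \<Rightarrow> real^'l \<Rightarrow> real^'n"
    and g :: "'m \<Rightarrow> real^'n \<Rightarrow> real^'m \<Rightarrow> real^'n"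
  assumes g0: "locally_lipschitz_uniformly_on (UNIV \<times> U) V (\<lambda>v (x, u). g0 x u v)"
    and g: "\<And>i. locally_lipschitz_uniformly_on (UNIV \<times> U) {i} (\<lambda>i (x, u). g i x u)"
    and u: "AC_loc (ereal T) u" "u ` {0..<T} \<subseteq> U" and v: "v ` {0..<T} \<subseteq> V"
    and x: "caratheodory_solution g0 g T x0 u v x" and y: "caratheodory_solution g0 g T x0 u v y"
    and "t \<in> {0..<T}"
  shows "x t = y t"
proof (rule ccontr)
  assume "x t \<noteq> y t"
  define z where "z t = x t - y t" for t
  define B where "B = {t \<in> {0..<T}. z t \<noteq> 0}"
  have B: "t \<in> B" "bdd_below B" using \<open>x t \<noteq> y t\<close> \<open>t \<in> {0..<T}\<close> by (auto simp: B_def z_def)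
  define t0 where "t0 = Inf B"
  have "0 \<le> t0" unfolding t0_def using B by (intro cInf_greatest) (auto simp: B_def)
  have "t0 \<le> t" unfolding t0_def using B by (intro cInf_lower)
  then have "t0 < T" using \<open>t \<in> {0..<T}\<close> by auto
  have below: "z s = 0" if "0 \<le> s" "s < t0" for s
  proof (rule ccontr)
    assume "z s \<noteq> 0"
    then have "s \<in> B" using that \<open>t0 < T\<close> by (auto simp: B_def)
    then have "t0 \<le> s" unfolding t0_def using B by (intro cInf_lower)
    with that show False by simp
  qed
  define t1 where "t1 = (t0 + T) / 2"
  have t1: "t0 < t1" "t1 < T" using \<open>t0 < T\<close> by (auto simp: t1_def)
  then have t1h: "t1 \<in> horizon (ereal T)" using \<open>0 \<le> t0\<close> by (simp add: mem_horizon_ereal)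
  have AC: "AC_on 0 t1 x" "AC_on 0 t1 y" "AC_on 0 t1 u"
    using x y u t1h by (auto simp: caratheodory_solution_def AC_loc_def)
  then have ACz: "AC_on 0 t1 z" unfolding z_def[abs_def] by (intro AC_on_diff)
  \<comment> \<open>At a positive \<open>t0\<close> this follows from continuity, because
    \<open>z\<close> vanishes to the left; at 0 it is the common initial value.\<close>
  have z0: "z t0 = 0"
  proof (cases "t0 = 0")
    case True then show ?thesis using x y by (simp add: z_def caratheodory_solution_def)
  next
    case False
    show ?thesis
    proof (rule ccontr)
      assume "z t0 \<noteq> 0"
      moreover have "t0 \<in> {0..t1}" using \<open>0 \<le> t0\<close> t1 by simp
      ultimately obtain d where "d > 0" and d: "\<And>s. s \<in> {0..t1} \<Longrightarrow> dist s t0 < d \<Longrightarrow> dist (z s) (z t0) < norm (z t0)"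
        using AC_on_imp_continuous_on[OF ACz, unfolded continuous_on_iff, rule_format, of t0 "norm (z t0)"] by auto
      let ?s = "max 0 (t0 - d/2)"
      have s: "0 \<le> ?s" "?s < t0" "dist ?s t0 < d" using \<open>d > 0\<close> \<open>0 \<le> t0\<close> False
        by (auto simp: dist_real_def max_def abs_if)
      then have "dist (z ?s) (z t0) < norm (z t0)" using t1 by (intro d) auto
      then show False using below[OF s(1,2)] by simp
    qed
  qed
  have uU: "u s \<in> U" if "0 \<le> s" "s < T" for s using u(2) that by auto
  obtain r K1 K2 where rK: "0 < r" "0 \<le> K1" "0 \<le> K2" and lip: "\<And>p q w c b. \<lbrakk>w \<in> U; c \<in> V;
      dist (x t0, u t0) (p, w) \<le> r; dist (x t0, u t0) (q, w) \<le> r\<rbrakk> \<Longrightarrow>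
      norm (dynamics g0 g p w c 1 b - dynamics g0 g q w c 1 b) \<le> (K1 + K2 * norm b) * norm (p - q)"
    using dynamics_locally_lipschitz[OF g0 g uU[OF \<open>0 \<le> t0\<close> \<open>t0 < T\<close>], of "x t0"] by blast
  \<comment> \<open>Used for \<open>x\<close> and for \<open>y\<close>: near \<open>t0\<close> both
    stay in the ball around their common value where one pair of Lipschitz constants is
    valid.\<close>
  have near: "\<exists>d>0. \<forall>s\<in>{0..t1}. dist s t0 < d \<longrightarrow> dist (f s, u s) (f t0, u t0) < r"
    if "AC_on 0 t1 f" for f :: "real \<Rightarrow> real^'n"
  proof -
    have "continuous_on {0..t1} (\<lambda>s. (f s, u s))"
      using that AC by (intro continuous_intros AC_on_imp_continuous_on)
    then show ?thesis using \<open>0 \<le> t0\<close> t1 rK by (auto simp: continuous_on_iff)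
  qed
  obtain d1 where "d1 > 0" and d1: "\<forall>s\<in>{0..t1}. dist s t0 < d1 \<longrightarrow> dist (x s, u s) (x t0, u t0) < r"
    using near[OF AC(1)] by blast
  obtain d2 where "d2 > 0" and d2: "\<forall>s\<in>{0..t1}. dist s t0 < d2 \<longrightarrow> dist (y s, u s) (y t0, u t0) < r"
    using near[OF AC(2)] by blast
  define b where "b = min t1 (t0 + min d1 d2 / 2)"
  have b: "t0 < b" "b \<le> t1" "b - t0 < d1" "b - t0 < d2"
    using t1 \<open>d1 > 0\<close> \<open>d2 > 0\<close> by (auto simp: b_def min_def)
  obtain N1 where N1: "negligible N1" "\<And>t. t \<in> {0..<T} - N1 \<Longrightarrow> \<exists>u'.
        (u has_vector_derivative u') (at t) \<and> (x has_vector_derivative dynamics g0 g (x t) (u t) (v t) 1 u') (at t)"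
    using x AE_lebesgue_on_iff_negligible[of "{0..<T}"] unfolding caratheodory_solution_def by auto
  obtain N2 where N2: "negligible N2" "\<And>t. t \<in> {0..<T} - N2 \<Longrightarrow> \<exists>u'.
        (u has_vector_derivative u') (at t) \<and> (y has_vector_derivative dynamics g0 g (y t) (u t) (v t) 1 u') (at t)"
    using y AE_lebesgue_on_iff_negligible[of "{0..<T}"] unfolding caratheodory_solution_def by auto
  have "\<exists>c. t0 < c \<and> c \<le> b \<and> (\<forall>t\<in>{t0..c}. z t = 0)"
  proof (rule AC_gronwall_local[where N = "N1 \<union> N2" and w = u])
    show "AC_on t0 b z" "AC_on t0 b u"
      using AC_on_subset[OF ACz] AC_on_subset[OF AC(3)] \<open>0 \<le> t0\<close> b by auto
    show "\<exists>z' w'. (z has_vector_derivative z') (at t) \<and> (u has_vector_derivative w') (at t) \<and>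
        norm z' \<le> (K1 + K2 * norm w') * norm (z t)" if t: "t \<in> {t0..b} - (N1 \<union> N2)" for t
    proof -
      have tT: "t \<in> {0..<T} - N1" "t \<in> {0..<T} - N2" "t \<in> {0..t1}" using t \<open>0 \<le> t0\<close> b t1 by auto
      obtain u' where u': "(u has_vector_derivative u') (at t)"
        "(x has_vector_derivative dynamics g0 g (x t) (u t) (v t) 1 u') (at t)" using N1(2)[OF tT(1)] by blast
      obtain u'' where u'': "(u has_vector_derivative u'') (at t)"
        "(y has_vector_derivative dynamics g0 g (y t) (u t) (v t) 1 u'') (at t)" using N2(2)[OF tT(2)] by blast
      \<comment> \<open>The two equations come with separate witnesses for the derivative of
        \<open>u\<close>; the Lipschitz estimate needs the same one in both.\<close>
      have [simp]: "u'' = u'" using vector_derivative_unique_at u'(1) u''(1) by blast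
      have "(z has_vector_derivative
          dynamics g0 g (x t) (u t) (v t) 1 u' - dynamics g0 g (y t) (u t) (v t) 1 u') (at t)"
        unfolding z_def[abs_def] using u' u'' by (auto intro: has_vector_derivative_diff)
      moreover have "norm (dynamics g0 g (x t) (u t) (v t) 1 u' - dynamics g0 g (y t) (u t) (v t) 1 u')
          \<le> (K1 + K2 * norm u') * norm (z t)"
        unfolding z_def
      proof (rule lip)
        have "dist t t0 < d1" "dist t t0 < d2" using t b by (auto simp: dist_real_def)
        with tT d1 d2 have "dist (x t, u t) (x t0, u t0) < r" "dist (y t, u t) (y t0, u t0) < r" by blast+
        moreover have "x t0 = y t0" using z0 by (simp add: z_def)
        ultimately show "dist (x t0, u t0) (x t, u t) \<le> r" "dist (x t0, u t0) (y t, u t) \<le> r"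
          by (simp_all add: dist_commute)
        show "u t \<in> U" "v t \<in> V" using tT u v by auto
      qed
      ultimately show ?thesis using u' by blast
    qed
  qed (use b rK z0 N1 N2 in auto)
  then obtain c where c: "t0 < c" "c \<le> b" "\<forall>t\<in>{t0..c}. z t = 0" by blast
  \<comment> \<open>Agreement before \<open>t0\<close> and on \<open>{t0..c}\<close> makes
    \<open>c\<close> a lower bound of \<open>B\<close>, contradicting
    \<open>t0 = Inf B < c\<close>.\<close>
  have "c \<le> t0"
    unfolding t0_def
  proof (rule cInf_greatest)
    fix s assume "s \<in> B"
    then have "z s \<noteq> 0" "0 \<le> s" by (auto simp: B_def)
    then show "c \<le> s" using below[of s] c(3) by (metis atLeastAtMost_iff linorder_not_le less_imp_le)
  qed (use B in auto)
  with c show False by simp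
qed

subsection \<open>Reparametrisation by the clock\<close>

lemma feasible_lipschitz:
  assumes "(\<phi>0, \<phi>, \<psi>, S) \<in> feasible_space_time_controls U V T u0"
    and "r \<in> horizon S" "s \<in> horizon S"
  shows "dist (\<phi>0 r) (\<phi>0 s) \<le> dist r s" "dist (\<phi> r) (\<phi> s) \<le> dist r s"
proof -
  have "dist (\<phi>0 r, \<phi> r) (\<phi>0 s, \<phi> s) \<le> dist r s"
    using assms lipschitz_onD[of 1 "horizon S" "\<lambda>s. (\<phi>0 s, \<phi> s)" r s]
    by (auto simp: feasible_space_time_controls_def)
  then show "dist (\<phi>0 r) (\<phi>0 s) \<le> dist r s" "dist (\<phi> r) (\<phi> s) \<le> dist r s"
    using dist_fst_le[of "(\<phi>0 r, \<phi> r)" "(\<phi>0 s, \<phi> s)"] dist_snd_le[of "(\<phi>0 r, \<phi> r)" "(\<phi>0 s, \<phi> s)"]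
    by auto
qed

text \<open>The function \<open>s - \<phi>\<^sub>0(s)\<close> has a derivative in \<open>[0,1]\<close>, hence is 1-Lipschitz.\<close>

lemma feasible_mono:
  assumes "(\<phi>0, \<phi>, \<psi>, S) \<in> feasible_space_time_controls U V T u0"
  shows "mono_on (horizon S) \<phi>0"
proof (rule mono_onI)
  fix r s assume rs: "r \<in> horizon S" "s \<in> horizon S" "r \<le> s"
  have sub: "{r..s} \<subseteq> horizon S"
    using horizon_downward_closed[OF rs(2)] rs(1) by (auto simp: horizon_def)
  have ae: "AE s in lebesgue_on (horizon S). \<exists>a b.
           (\<phi>0 has_real_derivative a) (at s) \<and> (\<phi> has_vector_derivative b) (at s) \<and>
           0 \<le> a \<and> a + norm b = 1"
    using assms by (auto simp: feasible_space_time_controls_def)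
  have "1-lipschitz_on {r..s} \<phi>0"
    using feasible_lipschitz(1)[OF assms subsetD[OF sub] subsetD[OF sub]]
    by (intro lipschitz_onI) auto
  then have AC: "AC_on r s (\<lambda>t. t - \<phi>0 t)"
    by (intro AC_on_diff AC_on_lipschitz[where L = 1]) (auto intro!: lipschitz_onI)
  obtain N where "negligible N" and N: "\<And>s. s \<in> horizon S - N \<Longrightarrow> \<exists>a b.
           (\<phi>0 has_real_derivative a) (at s) \<and> (\<phi> has_vector_derivative b) (at s) \<and>
           0 \<le> a \<and> a + norm b = 1"
    using ae AE_lebesgue_on_iff_negligible[OF horizon_sets_lebesgue[of S]] by auto
  \<comment> \<open>An increment of \<open>t - \<phi>0 t\<close> not exceeding \<open>s - r\<close>
    is the same as a nonnegative increment of \<open>\<phi>0\<close>.\<close>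
  have "norm ((s - \<phi>0 s) - (r - \<phi>0 r)) \<le> 1 * (s - r)"
  proof (rule AC_on_deriv_bound[OF \<open>r \<le> s\<close> AC \<open>negligible N\<close>])
    fix t assume "t \<in> {r..s} - N"
    then obtain a b where ab: "(\<phi>0 has_real_derivative a) (at t)" "0 \<le> a" "a + norm (b :: real^'a) = 1"
      using N[of t] sub by blast
    then have "((\<lambda>t. t - \<phi>0 t) has_vector_derivative 1 - a) (at t)"
      by (auto intro!: derivative_intros simp: has_real_derivative_iff_has_vector_derivative)
    moreover have "norm (1 - a) \<le> 1" using ab norm_ge_zero[of b] unfolding real_norm_def by linarith
    ultimately show "\<exists>z'. ((\<lambda>t. t - \<phi>0 t) has_vector_derivative z') (at t) \<and> norm z' \<le> 1" by blast
  qed simp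
  then show "\<phi>0 r \<le> \<phi>0 s" using \<open>r \<le> s\<close> by simp
qed

text \<open>Feasibility and the space-time equation each provide their own \<open>a\<close> and
  \<open>b\<close>. Uniqueness of derivatives identifies them off the union of the two null sets, so
  the normalisation \<open>a + norm b = 1\<close> applies to the coefficients of the
  equation.\<close>

lemma feasible_solution_ae:
  assumes "(\<phi>0, \<phi>, \<psi>, S) \<in> feasible_space_time_controls U V T u0"
    and "space_time_solution g0 g x0 \<phi>0 \<phi> \<psi> S \<xi>"
  shows "\<exists>N. negligible N \<and> (\<forall>s\<in>horizon S - N. \<exists>a b. (\<phi>0 has_real_derivative a) (at s) \<and>
    (\<phi> has_vector_derivative b) (at s) \<and> 0 \<le> a \<and> a + norm b = 1 \<and>
    (\<xi> has_vector_derivative dynamics g0 g (\<xi> s) (\<phi> s) (\<psi> s) a b) (at s))"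
proof -
  note ae = AE_lebesgue_on_iff_negligible[OF horizon_sets_lebesgue[of S]]
  obtain N1 where "negligible N1" and N1: "\<And>s. s \<in> horizon S - N1 \<Longrightarrow> \<exists>a b.
           (\<phi>0 has_real_derivative a) (at s) \<and> (\<phi> has_vector_derivative b) (at s) \<and>
           0 \<le> a \<and> a + norm b = 1"
    using assms(1) ae by (auto simp: feasible_space_time_controls_def)
  obtain N2 where "negligible N2" and N2: "\<And>s. s \<in> horizon S - N2 \<Longrightarrow> \<exists>a b.
        (\<phi>0 has_real_derivative a) (at s) \<and> (\<phi> has_vector_derivative b) (at s) \<and>
        (\<xi> has_vector_derivative dynamics g0 g (\<xi> s) (\<phi> s) (\<psi> s) a b) (at s)"
    using assms(2) ae by (auto simp: space_time_solution_def)
  have "\<exists>a b. (\<phi>0 has_real_derivative a) (at s) \<and>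
    (\<phi> has_vector_derivative b) (at s) \<and> 0 \<le> a \<and> a + norm b = 1 \<and>
    (\<xi> has_vector_derivative dynamics g0 g (\<xi> s) (\<phi> s) (\<psi> s) a b) (at s)"
    if s: "s \<in> horizon S - (N1 \<union> N2)" for s
  proof -
    have s12: "s \<in> horizon S - N1" "s \<in> horizon S - N2" using s by auto
    obtain a b where ab: "(\<phi>0 has_real_derivative a) (at s)" "(\<phi> has_vector_derivative b) (at s)"
      "0 \<le> a" "a + norm b = 1" using N1[OF s12(1)] by blast
    obtain a' b' where ab': "(\<phi>0 has_real_derivative a') (at s)" "(\<phi> has_vector_derivative b') (at s)"
      "(\<xi> has_vector_derivative dynamics g0 g (\<xi> s) (\<phi> s) (\<psi> s) a' b') (at s)" using N2[OF s12(2)] by blast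
    have "a' = a" using DERIV_unique ab(1) ab'(1) by blast
    moreover have "b' = b" using vector_derivative_unique_at ab(2) ab'(2) by blast
    ultimately show ?thesis using ab ab' by blast
  qed
  then show ?thesis using \<open>negligible N1\<close> \<open>negligible N2\<close> by (intro exI[of _ "N1 \<union> N2"]) auto
qed

text \<open>A positive derivative together with monotonicity separates \<open>f\<close> strictly
  from the value \<open>t\<close> on each side of \<open>\<tau> t\<close>. This makes the fibre a
  single point and forces \<open>\<tau>\<close> to be continuous at \<open>t\<close>, although it
  may jump elsewhere; the inverse function rule needs no more.\<close>

lemma right_inverse_at_regular_point:
  fixes f \<tau> :: "real \<Rightarrow> real"
  assumes mono: "mono_on (horizon S) f" and f0: "f 0 = 0"
    and \<tau>: "\<And>t. 0 \<le> t \<Longrightarrow> t < T \<Longrightarrow> \<tau> t \<in> horizon S \<and> f (\<tau> t) = t"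
    and t: "0 < t" "t < T" and a: "(f has_real_derivative a) (at (\<tau> t))" "a > 0"
  shows "(\<tau> has_real_derivative inverse a) (at t)"
    and "\<And>s. s \<in> horizon S \<Longrightarrow> f s = t \<Longrightarrow> s = \<tau> t"
proof -
  have \<tau>t: "\<tau> t \<in> horizon S" "f (\<tau> t) = t" using \<tau>[of t] t by auto
  have pos: "\<tau> t > 0" using \<tau>t f0 t by (metis horizon_def less_eq_real_def less_irrefl mem_Collect_eq)
  \<comment> \<open>The derivative yields strict increase only next to \<open>\<tau> t\<close>;
    monotonicity carries it to every later parameter.\<close>
  have right: "f s > t" if s: "s \<in> horizon S" "s > \<tau> t" for s
  proof -
    obtain d where "d > 0" and d: "\<And>h. 0 < h \<Longrightarrow> h < d \<Longrightarrow> f (\<tau> t) < f (\<tau> t + h)"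
      using DERIV_pos_inc_right[OF a] by blast
    let ?h = "min (d/2) (s - \<tau> t)"
    have "?h > 0" "?h < d" "\<tau> t + ?h \<le> s" using \<open>d > 0\<close> s by (auto simp: min_def)
    moreover have "\<tau> t + ?h \<in> horizon S" using horizon_downward_closed[OF s(1)] calculation pos by auto
    ultimately have "f (\<tau> t) < f s"
      using d[of ?h] mono_onD[OF mono, of "\<tau> t + ?h" s] s by linarith
    then show ?thesis using \<tau>t by simp
  qed
  have left: "f s < t" if s: "s \<in> horizon S" "s < \<tau> t" for s
  proof -
    obtain d where "d > 0" and d: "\<And>h. 0 < h \<Longrightarrow> h < d \<Longrightarrow> f (\<tau> t - h) < f (\<tau> t)"
      using DERIV_pos_inc_left[OF a] by blast
    let ?h = "min (d/2) (\<tau> t - s)"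
    have "?h > 0" "?h < d" "s \<le> \<tau> t - ?h" using \<open>d > 0\<close> s by (auto simp: min_def)
    moreover have "\<tau> t - ?h \<in> horizon S"
      using s calculation by (intro horizon_downward_closed[OF \<tau>t(1)]) (auto simp: horizon_def)
    ultimately have "f s < f (\<tau> t)"
      using d[of ?h] mono_onD[OF mono, of s "\<tau> t - ?h"] s by linarith
    then show ?thesis using \<tau>t by simp
  qed
  show "s = \<tau> t" if "s \<in> horizon S" "f s = t" for s
    using left[of s] right[of s] that by (cases s "\<tau> t" rule: linorder_cases) auto
  have ev: "\<forall>\<^sub>F t' in at t. 0 < t' \<and> t' < T"
    using eventually_at_in_open'[of "{0<..<T}" t] t by (auto elim!: eventually_mono)
  have "(\<tau> \<longlongrightarrow> \<tau> t) (at t)"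
  proof (rule order_tendstoI)
    fix c assume "c < \<tau> t"
    let ?s = "max c 0"
    have s: "?s \<in> horizon S" "?s < \<tau> t"
      using \<open>c < \<tau> t\<close> pos horizon_downward_closed[OF \<tau>t(1), of ?s] by auto
    have "\<forall>\<^sub>F t' in at t. f ?s < t'" using left[OF s] by (rule order_tendstoD[OF tendsto_ident_at])
    with ev show "\<forall>\<^sub>F t' in at t. c < \<tau> t'"
    proof eventually_elim
      case (elim t')
      then have "\<not> \<tau> t' \<le> ?s" using \<tau>[of t'] mono_onD[OF mono, of "\<tau> t'" ?s] s by auto
      then show ?case by simp
    qed
  next
    fix c assume "\<tau> t < c"
    \<comment> \<open>The level \<open>c\<close> may lie outside the horizon, so it is cut down to a
      parameter of the horizon beyond \<open>\<tau> t\<close>.\<close>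
    obtain q where q: "q \<in> horizon S" "\<tau> t < q" using horizon_no_max[OF \<tau>t(1)] by blast
    let ?s = "min c q"
    have s: "?s \<in> horizon S" "\<tau> t < ?s"
      using \<open>\<tau> t < c\<close> pos q horizon_downward_closed[OF q(1), of ?s] by auto
    have "\<forall>\<^sub>F t' in at t. t' < f ?s" using right[OF s] by (rule order_tendstoD[OF tendsto_ident_at])
    with ev show "\<forall>\<^sub>F t' in at t. \<tau> t' < c"
    proof eventually_elim
      case (elim t')
      then have "\<not> ?s \<le> \<tau> t'" using \<tau>[of t'] mono_onD[OF mono, of ?s "\<tau> t'"] s by auto
      then show ?case by simp
    qed
  qed
  then have "continuous (at t) \<tau>" by (simp add: isCont_def)
  then show "(\<tau> has_real_derivative inverse a) (at t)"
    using a t \<tau> by (intro has_field_derivative_inverse_basic[of f, where t = "{0<..<T}"]) auto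
qed

theorem clock_solution_caratheodory:
  fixes x :: "real \<Rightarrow> real^'n" and u :: "real \<Rightarrow> real^'m"
  assumes "T > 0" and completion: "BV_loc_graph_completion U V T u0 u v \<phi>0 \<phi> \<psi> S"
    and \<xi>: "space_time_solution g0 g x0 \<phi>0 \<phi> \<psi> S \<xi>"
    and \<tau>: "\<And>t. 0 \<le> t \<Longrightarrow> t < T \<Longrightarrow>
      \<tau> t \<in> horizon S \<and> \<phi>0 (\<tau> t) = t \<and> \<phi> (\<tau> t) = u t \<and> x t = \<xi> (\<tau> t)"
    and "\<tau> 0 = 0" and "AC_loc (ereal T) x"
  shows "caratheodory_solution g0 g T x0 u v x"
proof -
  have feas: "(\<phi>0, \<phi>, \<psi>, S) \<in> feasible_space_time_controls U V T u0"
    and fibre: "\<And>t. t \<in> {0..<T} \<Longrightarrow> \<exists>s\<in>horizon S. \<phi>0 s = t \<and> \<phi> s = u t \<and> \<psi> s = v t"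
    using completion by (auto simp: BV_loc_graph_completion_def)
  have mono: "mono_on (horizon S) \<phi>0" using feas by (rule feasible_mono)
  have \<phi>00: "\<phi>0 0 = 0"
    using feas by (auto simp: feasible_space_time_controls_def)
  obtain E where "negligible E" and E: "\<And>s. s \<in> horizon S - E \<Longrightarrow> \<exists>a b. (\<phi>0 has_real_derivative a) (at s) \<and>
    (\<phi> has_vector_derivative b) (at s) \<and> 0 \<le> a \<and> a + norm b = 1 \<and>
    (\<xi> has_vector_derivative dynamics g0 g (\<xi> s) (\<phi> s) (\<psi> s) a b) (at s)"
    using feasible_solution_ae[OF feas \<xi>] by blast
  define Z where "Z = {s. (\<phi>0 has_real_derivative 0) (at s)}"
  \<comment> \<open>The point 0 is added so that the remaining times are interior to
    \<open>{0..<T}\<close> and two-sided derivatives make sense.\<close>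
  define N where "N = {0} \<union> \<phi>0 ` (horizon S \<inter> E) \<union> \<phi>0 ` Z"
  have "negligible (\<phi>0 ` (horizon S \<inter> E))"
  proof (rule negligible_locally_Lipschitz_image)
    fix s assume s: "s \<in> horizon S \<inter> E"
    have "norm (\<phi>0 y - \<phi>0 s) \<le> 1 * norm (y - s)" if "y \<in> horizon S" for y
      using feasible_lipschitz(1)[OF feas, of y s] that s by (simp add: dist_norm)
    then show "\<exists>T B. open T \<and> s \<in> T \<and> (\<forall>y\<in>horizon S \<inter> E \<inter> T. norm (\<phi>0 y - \<phi>0 s) \<le> B * norm (y - s))"
      by (intro exI[of _ UNIV] exI[of _ "1::real"]) auto
  qed (use \<open>negligible E\<close> in \<open>auto intro: negligible_subset\<close>)
  moreover have "negligible (\<phi>0 ` Z)" by (rule negligible_image_deriv_0) (simp add: Z_def)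
  ultimately have "negligible N" unfolding N_def by (simp add: negligible_Un)
  moreover have "\<exists>u'. (u has_vector_derivative u') (at t) \<and>
        (x has_vector_derivative dynamics g0 g (x t) (u t) (v t) 1 u') (at t)"
    if t: "t \<in> {0..<T} - N" for t
  proof -
    have t0: "0 < t" "t < T" using t by (auto simp: N_def less_eq_real_def)
    have \<tau>t: "\<tau> t \<in> horizon S" "\<phi>0 (\<tau> t) = t" "\<phi> (\<tau> t) = u t" "x t = \<xi> (\<tau> t)" using \<tau>[of t] t0 by auto
    have "\<tau> t \<notin> E" "\<tau> t \<notin> Z" using t \<tau>t imageI[of "\<tau> t" "horizon S \<inter> E" \<phi>0] imageI[of "\<tau> t" Z \<phi>0]
      by (auto simp: N_def)
    then obtain a b where ab: "(\<phi>0 has_real_derivative a) (at (\<tau> t))"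
      "(\<phi> has_vector_derivative b) (at (\<tau> t))" "0 \<le> a"
      "(\<xi> has_vector_derivative dynamics g0 g (\<xi> (\<tau> t)) (\<phi> (\<tau> t)) (\<psi> (\<tau> t)) a b) (at (\<tau> t))"
      using E[of "\<tau> t"] \<tau>t by blast
    then have "a > 0" using \<open>\<tau> t \<notin> Z\<close> by (auto simp: Z_def less_eq_real_def)
    have \<tau>f: "\<And>t. 0 \<le> t \<Longrightarrow> t < T \<Longrightarrow> \<tau> t \<in> horizon S \<and> \<phi>0 (\<tau> t) = t" using \<tau> by blast
    note reg = right_inverse_at_regular_point[OF mono \<phi>00 \<tau>f t0 ab(1) \<open>a > 0\<close>]
    have \<tau>': "(\<tau> has_vector_derivative inverse a) (at t)"
      using reg(1) by (simp add: has_real_derivative_iff_has_vector_derivative)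
    \<comment> \<open>The completion realises \<open>v t\<close> somewhere in the fibre over
      \<open>t\<close>, not necessarily at the clock value; the fibre being a single point
      identifies the two.\<close>
    have "\<psi> (\<tau> t) = v t" using fibre[of t] reg(2) t by auto
    have chain: "(f has_vector_derivative inverse a *\<^sub>R F') (at t)"
      if "(F has_vector_derivative F') (at (\<tau> t))" "\<And>t. 0 \<le> t \<Longrightarrow> t < T \<Longrightarrow> F (\<tau> t) = f t"
      for F f :: "real \<Rightarrow> real^'k" and F'
      using vector_diff_chain_at[OF \<tau>' that(1)]
      by (rule has_vector_derivative_transform_within_open[where S = "{0<..<T}"]) (use that(2) t0 in auto)
    have "(u has_vector_derivative inverse a *\<^sub>R b) (at t)"
      using ab(2) \<tau> by (intro chain[of \<phi>]) auto
    moreover have "(x has_vector_derivative inverse a *\<^sub>R dynamics g0 g (\<xi> (\<tau> t)) (\<phi> (\<tau> t)) (\<psi> (\<tau> t)) a b) (at t)"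
      using ab(4) \<tau> by (intro chain[of \<xi>]) auto
    \<comment> \<open>\<open>dynamics\<close> is linear in the pair \<open>(a, b)\<close>. Division
      by \<open>a\<close> normalises the first entry to 1 and turns the second into the derivative
      of \<open>u\<close> just found.\<close>
    moreover have "inverse a *\<^sub>R dynamics g0 g (\<xi> (\<tau> t)) (\<phi> (\<tau> t)) (\<psi> (\<tau> t)) a b
        = dynamics g0 g (x t) (u t) (v t) 1 (inverse a *\<^sub>R b)"
      using \<tau>t \<open>\<psi> (\<tau> t) = v t\<close> \<open>a > 0\<close> by (simp add: dynamics_def scaleR_add_right scaleR_sum_right)
    ultimately show ?thesis by auto
  qed
  ultimately have "AE t in lebesgue_on {0..<T}. \<exists>u'. (u has_vector_derivative u') (at t) \<and>
        (x has_vector_derivative dynamics g0 g (x t) (u t) (v t) 1 u') (at t)"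
    by (subst AE_lebesgue_on_iff_negligible) auto
  moreover have "x 0 = x0" using \<tau>[of 0] \<open>\<tau> 0 = 0\<close> \<open>T > 0\<close> \<xi> by (simp add: space_time_solution_def)
  ultimately show ?thesis using assms(6) by (simp add: caratheodory_solution_def)
qed

subsection \<open>Behaviour at the final time\<close>

text \<open>The factor counts the fields: one term for \<open>g0\<close> and one for each index of
  \<open>g\<close>, each at most \<open>Q\<close>.\<close>

lemma dynamics_norm_bound:
  fixes g0 :: "real^'n \<Rightarrow> real^'m \<Rightarrow> real^'l \<Rightarrow> real^'n"
  assumes "norm (g0 x u v, (\<chi> i. g i x u)) \<le> Q" "\<bar>a\<bar> \<le> 1" "norm b \<le> 1"
  shows "norm (dynamics g0 g x u v a b) \<le> (1 + real CARD('m)) * Q"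
proof -
  have g0: "norm (g0 x u v) \<le> Q" using assms(1) norm_fst_le order_trans by blast
  then have "0 \<le> Q" using norm_ge_zero order_trans by blast
  have g: "norm (g i x u) \<le> Q" for i
  proof -
    have "norm (g i x u) \<le> norm (\<chi> i. g i x u)" using Finite_Cartesian_Product.norm_nth_le[of "\<chi> i. g i x u" i] by simp
    also have "\<dots> \<le> Q" using assms(1) norm_snd_le order_trans by blast
    finally show ?thesis .
  qed
  have "norm ((b $ i) *\<^sub>R g i x u) \<le> Q" for i
  proof -
    have "\<bar>b $ i\<bar> \<le> 1" using component_le_norm_cart[of b i] assms(3) by simp
    then have "\<bar>b $ i\<bar> * norm (g i x u) \<le> 1 * Q" using g \<open>0 \<le> Q\<close> by (intro mult_mono) auto
    then show ?thesis by simp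
  qed
  then have "norm (\<Sum>i\<in>UNIV. (b $ i) *\<^sub>R g i x u) \<le> (\<Sum>i\<in>(UNIV::'m set). Q)"
    by (intro sum_norm_le)
  moreover have "norm (a *\<^sub>R g0 x u v) \<le> Q"
    using mult_mono[OF assms(2) g0] by simp
  moreover have "norm (a *\<^sub>R g0 x u v + (\<Sum>i\<in>UNIV. (b $ i) *\<^sub>R g i x u))
      \<le> norm (a *\<^sub>R g0 x u v) + norm (\<Sum>i\<in>UNIV. (b $ i) *\<^sub>R g i x u)"
    by (rule norm_triangle_ineq)
  ultimately show ?thesis by (simp add: dynamics_def distrib_right)
qed

text \<open>Along a bounded trajectory with controls in a compact \<open>U\<close> the growth
  condition bounds all the fields, and the normalisation of the parameter bounds their coefficients
  by 1. The Lipschitz constant is therefore uniform up to an infinite horizon.\<close>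

lemma space_time_solution_lipschitz:
  fixes g0 :: "real^'n \<Rightarrow> real^'m \<Rightarrow> real^'l \<Rightarrow> real^'n"
  assumes "compact U"
    and growth: "\<And>x u v. u \<in> U \<Longrightarrow> v \<in> V \<Longrightarrow>
           norm (g0 x u v, (\<chi> i. g i x u)) \<le> M * (1 + norm (x, u))" and "M > 0"
    and feas: "(\<phi>0, \<phi>, \<psi>, S) \<in> feasible_space_time_controls U V T u0"
    and \<xi>: "space_time_solution g0 g x0 \<phi>0 \<phi> \<psi> S \<xi>" and "bounded (\<xi> ` horizon S)"
  shows "\<exists>C\<ge>0. \<forall>r\<in>horizon S. \<forall>s\<in>horizon S. dist (\<xi> r) (\<xi> s) \<le> C * dist r s"
proof -
  obtain R where R: "\<And>s. s \<in> horizon S \<Longrightarrow> norm (\<xi> s) \<le> R"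
    using assms(6) by (auto simp: bounded_iff)
  obtain B where B: "\<And>w. w \<in> U \<Longrightarrow> norm w \<le> B"
    using compact_imp_bounded[OF \<open>compact U\<close>] by (auto simp: bounded_iff)
  have UV: "\<phi> s \<in> U" "\<psi> s \<in> V" if "s \<in> horizon S" for s
    using feas that by (auto simp: feasible_space_time_controls_def)
  obtain N where "negligible N" and N: "\<And>s. s \<in> horizon S - N \<Longrightarrow> \<exists>a b. (\<phi>0 has_real_derivative a) (at s) \<and>
    (\<phi> has_vector_derivative b) (at s) \<and> 0 \<le> a \<and> a + norm b = 1 \<and>
    (\<xi> has_vector_derivative dynamics g0 g (\<xi> s) (\<phi> s) (\<psi> s) a b) (at s)"
    using feasible_solution_ae[OF feas \<xi>] by blast
  define Q where "Q = M * (1 + (\<bar>R\<bar> + \<bar>B\<bar>))"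
  have Q: "norm (g0 (\<xi> s) (\<phi> s) (\<psi> s), (\<chi> i. g i (\<xi> s) (\<phi> s))) \<le> Q" if s: "s \<in> horizon S" for s
  proof -
    have "norm (\<xi> s, \<phi> s) \<le> \<bar>R\<bar> + \<bar>B\<bar>"
      using norm_Pair_le[of "\<xi> s" "\<phi> s"] R[OF s] B[OF UV(1)[OF s]] by linarith
    then have "M * (1 + norm (\<xi> s, \<phi> s)) \<le> Q" using \<open>M > 0\<close> by (simp add: Q_def)
    then show ?thesis using growth[OF UV[OF s]] order_trans by blast
  qed
  define C where "C = (1 + real CARD('m)) * Q"
  have "Q \<ge> 0" using \<open>M > 0\<close> by (simp add: Q_def)
  then have "C \<ge> 0" by (simp add: C_def)
  have le: "norm (\<xi> s - \<xi> r) \<le> C * (s - r)" if rs: "r \<in> horizon S" "s \<in> horizon S" "r \<le> s" for r s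
  proof (rule AC_on_deriv_bound[OF \<open>r \<le> s\<close> _ \<open>negligible N\<close> \<open>C \<ge> 0\<close>])
    show "AC_on r s \<xi>"
      using \<xi> rs by (intro AC_on_subset[of 0 s \<xi> r s]) (auto simp: space_time_solution_def AC_loc_def horizon_def)
    fix t assume t: "t \<in> {r..s} - N"
    then have tS: "t \<in> horizon S"
      using horizon_downward_closed[OF rs(2), of t] rs(1) by (auto simp: horizon_def)
    then obtain a b where ab: "0 \<le> a" "a + norm b = 1"
      "(\<xi> has_vector_derivative dynamics g0 g (\<xi> t) (\<phi> t) (\<psi> t) a b) (at t)" using N[of t] t by blast
    then have "\<bar>a\<bar> \<le> 1" "norm b \<le> 1" using norm_ge_zero[of b] by linarith+
    then have "norm (dynamics g0 g (\<xi> t) (\<phi> t) (\<psi> t) a b) \<le> C"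
      unfolding C_def using Q[OF tS] by (intro dynamics_norm_bound)
    then show "\<exists>z'. (\<xi> has_vector_derivative z') (at t) \<and> norm z' \<le> C" using ab(3) by blast
  qed
  have "dist (\<xi> r) (\<xi> s) \<le> C * dist r s" if "r \<in> horizon S" "s \<in> horizon S" for r s
    using le[of r s] le[of s r] that by (cases "r \<le> s") (auto simp: dist_norm norm_minus_commute)
  then show ?thesis using \<open>C \<ge> 0\<close> by blast
qed

text \<open>Boundedness is imposed on \<open>\<xi>\<close> only when \<open>S = \<infinity>\<close>.
  For finite \<open>S\<close> it follows from continuity on a compact initial piece and convergence
  on the rest.\<close>

lemma bounded_if_convergent_to_end:
  fixes \<xi> :: "real \<Rightarrow> 'a::real_normed_vector"
  assumes AC: "AC_loc S \<xi>" and "S < \<infinity>" and lim: "(\<xi> \<longlongrightarrow> p) (to_end S)"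
  shows "bounded (\<xi> ` horizon S)"
proof (cases S)
  case (real r)
  then have "(\<xi> \<longlongrightarrow> p) (at_left r)" using lim by (simp add: to_end_def)
  then have "\<forall>\<^sub>F s in at_left r. dist (\<xi> s) p < 1" by (rule tendstoD) simp
  then obtain c where c: "c < r" "\<And>s. c < s \<Longrightarrow> s < r \<Longrightarrow> dist (\<xi> s) p < 1"
    using eventually_at_left[of "r - 1" r] by auto
  have "bounded (\<xi> ` {0..c})"
  proof (cases "0 \<le> c")
    case True
    then have "c \<in> horizon S" using c real by (simp add: horizon_def)
    then have "continuous_on {0..c} \<xi>" using AC by (intro AC_on_imp_continuous_on) (simp add: AC_loc_def)
    then show ?thesis by (intro compact_imp_bounded compact_continuous_image) auto
  qed simp
  moreover have "\<xi> ` horizon S \<subseteq> \<xi> ` {0..c} \<union> cball p 1"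
  proof
    fix y assume "y \<in> \<xi> ` horizon S"
    then obtain s where s: "0 \<le> s" "s < r" "y = \<xi> s" using real by (auto simp: horizon_def)
    then show "y \<in> \<xi> ` {0..c} \<union> cball p 1"
      using c(2)[of s] by (cases "s \<le> c") (auto simp: dist_commute)
  qed
  ultimately show ?thesis using bounded_subset bounded_Un bounded_cball by metis
qed (use assms in \<open>auto simp: horizon_def\<close>)

lemma limit_set_if_tendsto_at_left:
  assumes "T > 0" "(f \<longlongrightarrow> p) (at_left T)"
  shows "p \<in> limit_set (ereal T) f"
proof -
  \<comment> \<open>This sequence starts at 0, increases and stays below \<open>T\<close>, as
    \<open>limit_set\<close> demands.\<close>
  define s where "s j = T - T / (real j + 1)" for j
  have s: "0 \<le> s j" "s j < T" for j using \<open>T > 0\<close> by (auto simp: s_def field_simps)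
  have "(\<lambda>j. T - T * inverse (real j + 1)) \<longlonglongrightarrow> T - T * 0"
    by (intro tendsto_intros LIMSEQ_inverse_real_of_nat[unfolded of_nat_Suc] | simp add: add.commute)+
  then have lim: "s \<longlonglongrightarrow> T" by (simp add: s_def[abs_def] divide_inverse)
  moreover have "filterlim s (at_left T) sequentially"
    using lim s by (intro tendsto_imp_filterlim_at_left) (auto intro: always_eventually)
  then have "(\<lambda>j. f (s j)) \<longlonglongrightarrow> p" by (rule filterlim_compose[OF assms(2)])
  moreover have "incseq s" using \<open>T > 0\<close> unfolding s_def[abs_def] incseq_def by (auto simp: frac_le)
  moreover have "range s \<subseteq> horizon (ereal T)" using s by (auto simp: horizon_def)
  ultimately show ?thesis unfolding limit_set_def by auto
qed

text \<open>
  Needed because \<^const>\<open>emeasure\<close> of a non-measurable set is \<open>0\<close>, so that finiteness alone would say nothing.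
\<close>

lemma deriv_zero_set_lebesgue:
  fixes f :: "real \<Rightarrow> real"
  assumes cont: "continuous_on {0..} f" and "negligible N"
    and diff: "\<And>s. s \<in> {0..} - N \<Longrightarrow> \<exists>a. (f has_real_derivative a) (at s)"
  shows "{s. 0 \<le> s \<and> (f has_real_derivative 0) (at s)} \<in> sets lebesgue"
proof -
  define G where "G = {0<..} - N"
  have G: "G \<in> sets lebesgue" unfolding G_def using \<open>negligible N\<close> by (auto dest: negligible_imp_sets)
  obtain f' where f': "\<And>s. s \<in> {0..} - N \<Longrightarrow> (f has_real_derivative f' s) (at s)" using diff by metis
  have f'G: "(f has_real_derivative f' s) (at s)" if "s \<in> G" for s using f' that by (auto simp: G_def)
  \<comment> \<open>\<open>f'\<close> is the limit of forward difference quotients; forward steps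
    stay in \<open>{0..}\<close>, where \<open>f\<close> is continuous.\<close>
  have "f' \<in> borel_measurable (lebesgue_on G)"
  proof (rule borel_measurable_LIMSEQ_real)
    fix i :: nat
    have "continuous_on G (\<lambda>s. (f (s + 1 / real (Suc i)) - f s) / (1 / real (Suc i)))"
      by (intro continuous_intros continuous_on_compose2[OF cont] continuous_on_subset[OF cont])
        (auto simp: G_def)
    then show "(\<lambda>s. (f (s + 1 / real (Suc i)) - f s) / (1 / real (Suc i))) \<in> borel_measurable (lebesgue_on G)"
      using G by (rule continuous_imp_measurable_on_sets_lebesgue)
  next
    fix s assume "s \<in> space (lebesgue_on G)"
    then have "s \<in> G" by simp
    then have "((\<lambda>h. (f (s + h) - f s) / h) \<longlongrightarrow> f' s) (at 0)" using f'G by (simp add: DERIV_def)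
    moreover have "filterlim (\<lambda>i. 1 / real (Suc i)) (at 0) sequentially"
      using LIMSEQ_inverse_real_of_nat by (auto simp: filterlim_at inverse_eq_divide)
    ultimately show "(\<lambda>i. (f (s + 1 / real (Suc i)) - f s) / (1 / real (Suc i))) \<longlonglongrightarrow> f' s"
      by (rule filterlim_compose)
  qed
  then have "{s \<in> space (lebesgue_on G). f' s = 0} \<in> sets (lebesgue_on G)" by measurable
  then have A: "{s \<in> G. f' s = 0} \<in> sets lebesgue"
    using G by (auto simp: sets_restrict_space_iff)
  let ?Z = "{s. 0 \<le> s \<and> (f has_real_derivative 0) (at s)}"
  \<comment> \<open>What lies outside \<open>G\<close> is a subset of a null set, hence measurable
    because Lebesgue measure is complete.\<close>
  have "?Z - G \<subseteq> insert 0 N" by (auto simp: G_def)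
  then have "negligible (?Z - G)" using \<open>negligible N\<close> negligible_subset negligible_insert by blast
  then have un: "{s \<in> G. f' s = 0} \<union> (?Z - G) \<in> sets lebesgue"
    using A negligible_imp_sets by blast
  have eq: "?Z = {s \<in> G. f' s = 0} \<union> (?Z - G)"
  proof (intro equalityI subsetI)
    fix s assume s: "s \<in> ?Z"
    then show "s \<in> {s \<in> G. f' s = 0} \<union> (?Z - G)" using f'G[of s] DERIV_unique[of f "f' s" s 0] by auto
  next
    fix s assume "s \<in> {s \<in> G. f' s = 0} \<union> (?Z - G)"
    then show "s \<in> ?Z" using f'G[of s] by (auto simp: G_def)
  qed
  show ?thesis using un unfolding eq[symmetric] .
qed

text \<open>The interior of a flat interval starting beyond \<open>n\<close> lies in the part of the
  critical set beyond \<open>n\<close>. Finiteness of the measure permits continuity from above, so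
  these tails have measure tending to 0.\<close>

lemma flat_intervals_short:
  fixes f :: "real \<Rightarrow> real"
  assumes mono: "mono_on {0..} f"
    and Z: "{s. 0 \<le> s \<and> (f has_real_derivative 0) (at s)} \<in> sets lebesgue"
      "emeasure lebesgue {s. 0 \<le> s \<and> (f has_real_derivative 0) (at s)} < \<infinity>"
    and "e > 0"
  shows "\<exists>K\<ge>0. \<forall>a b. K \<le> a \<and> a \<le> b \<and> f a = f b \<longrightarrow> b - a < e"
proof -
  define A where "A n = {s. 0 \<le> s \<and> (f has_real_derivative 0) (at s)} \<inter> {real n..}" for n
  have A: "A n \<in> sets lebesgue" for n unfolding A_def using Z(1) by auto
  have "(\<lambda>n. emeasure lebesgue (A n)) \<longlonglongrightarrow> emeasure lebesgue (\<Inter>n. A n)"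
  proof (rule Lim_emeasure_decseq)
    show "decseq A" unfolding decseq_def A_def by auto
    have "emeasure lebesgue (A n) \<le> emeasure lebesgue {s. 0 \<le> s \<and> (f has_real_derivative 0) (at s)}" for n
      using Z(1) by (intro emeasure_mono) (auto simp: A_def)
    then show "emeasure lebesgue (A n) \<noteq> \<infinity>" for n
      using Z(2) by (metis infinity_ennreal_def leD less_top)
  qed (use A in auto)
  moreover have "(\<Inter>n. A n) = {}"
  proof -
    have "\<not> (\<forall>n. real n \<le> s)" for s using reals_Archimedean2[of s] by (auto simp: not_le)
    then show ?thesis by (auto simp: A_def)
  qed
  ultimately have "(\<lambda>n. emeasure lebesgue (A n)) \<longlonglongrightarrow> 0" by simp
  then have "\<forall>\<^sub>F n in sequentially. emeasure lebesgue (A n) < ennreal e"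
    by (rule order_tendstoD) (use \<open>e > 0\<close> in simp)
  then obtain n where n: "emeasure lebesgue (A n) < ennreal e" by (auto simp: eventually_sequentially)
  have "b - a < e" if ab: "real n \<le> a" "a \<le> b" "f a = f b" for a b
  proof -
    have "{a<..<b} \<subseteq> A n"
    proof
      fix s assume s: "s \<in> {a<..<b}"
      have flat: "f q = f a" if "q \<in> {a<..<b}" for q
        using mono_onD[OF mono, of a q] mono_onD[OF mono, of q b] ab that by auto
      have "((\<lambda>_. f a) has_real_derivative 0) (at s)" by simp
      then have "(f has_real_derivative 0) (at s)"
        by (rule has_field_derivative_transform_within_open[where S = "{a<..<b}"]) (use flat s in auto)
      then show "s \<in> A n" using s ab by (auto simp: A_def)
    qed
    then have "emeasure lebesgue {a<..<b} \<le> emeasure lebesgue (A n)" using A by (intro emeasure_mono) auto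
    then have "ennreal (b - a) < ennreal e" using n ab by simp
    then show ?thesis using \<open>e > 0\<close> by (simp add: ennreal_less_iff ab)
  qed
  then show ?thesis by (intro exI[of _ "real n"]) auto
qed

section \<open>Transfer of the endpoint from parameters to times\<close>

text \<open>Before \<open>T\<close> the clock lies between 0 and \<open>S\<close> strictly below
  \<open>S\<close>, hence is finite and may be replaced by a real function. Boundedness of
  \<open>\<xi>\<close> is added for both kinds of horizon.\<close>

lemma associated_solution_real_clock:
  assumes "associated_solution g0 g U V T x0 u0 u v \<phi>0 \<phi> \<psi> S \<sigma> x" "T > 0"
  shows "\<exists>\<xi> \<tau>. BV_loc_graph_completion U V T u0 u v \<phi>0 \<phi> \<psi> S \<and>
    space_time_solution g0 g x0 \<phi>0 \<phi> \<psi> S \<xi> \<and>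
    (\<forall>t. 0 \<le> t \<and> t < T \<longrightarrow>
      \<tau> t \<in> horizon S \<and> \<phi>0 (\<tau> t) = t \<and> \<phi> (\<tau> t) = u t \<and> x t = \<xi> (\<tau> t)) \<and>
    \<tau> 0 = 0 \<and> bounded (\<xi> ` horizon S) \<and>
    (S < \<infinity> \<longrightarrow> (\<xi> \<longlongrightarrow> x T) (to_end S)) \<and>
    (S = \<infinity> \<longrightarrow> (x T, u T) \<in> limit_set \<infinity> (\<lambda>s. (\<xi> s, \<phi> s)))"
proof -
  obtain \<xi> where clock: "is_clock T u \<phi>0 \<phi> S \<sigma>"
    and \<xi>: "BV_loc_graph_completion U V T u0 u v \<phi>0 \<phi> \<psi> S" "space_time_solution g0 g x0 \<phi>0 \<phi> \<psi> S \<xi>"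
      "S = \<infinity> \<Longrightarrow> bounded (\<xi> ` horizon S)" "\<And>t. t \<in> {0..<T} \<Longrightarrow> x t = \<xi> (real_of_ereal (\<sigma> t))"
      "S < \<infinity> \<Longrightarrow> (\<xi> \<longlongrightarrow> x T) (to_end S)" "S = \<infinity> \<Longrightarrow> (x T, u T) \<in> limit_set \<infinity> (\<lambda>s. (\<xi> s, \<phi> s))"
    using assms(1) unfolding associated_solution_def by blast
  show ?thesis
  proof (intro exI[of _ \<xi>] exI[of _ "\<lambda>t. real_of_ereal (\<sigma> t)"] conjI allI impI)
    fix t assume t: "0 \<le> t \<and> t < T"
    then have \<sigma>: "0 \<le> \<sigma> t" "\<sigma> t < S" "\<phi>0 (real_of_ereal (\<sigma> t)) = t" "\<phi> (real_of_ereal (\<sigma> t)) = u t"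
      using clock by (auto simp: is_clock_def)
    then have "real_of_ereal (\<sigma> t) \<in> horizon S" by (cases "\<sigma> t") (auto simp: horizon_def)
    then show "real_of_ereal (\<sigma> t) \<in> horizon S" "\<phi>0 (real_of_ereal (\<sigma> t)) = t"
      "\<phi> (real_of_ereal (\<sigma> t)) = u t" "x t = \<xi> (real_of_ereal (\<sigma> t))"
      using \<sigma> \<xi>(4) t by auto
  next
    show "real_of_ereal (\<sigma> 0) = 0" using clock by (simp add: is_clock_def)
    show "bounded (\<xi> ` horizon S)"
    proof (cases "S = \<infinity>")
      case False
      then show ?thesis using \<xi>(2,5) by (intro bounded_if_convergent_to_end) (auto simp: space_time_solution_def)
    qed (use \<xi>(3) in blast)
  qed (use \<xi> in auto)
qed

text \<open>Any parameter \<open>c\<close> in the horizon has \<open>\<phi>0 c < T\<close>, so times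
  \<open>t\<close> above \<open>\<phi>0 c\<close> have \<open>\<tau> t > c\<close>. Hence
  \<open>\<tau> t\<close> tends to \<open>S\<close>, and composing with the limit of
  \<open>f\<close> gives even a full left limit at \<open>T\<close>.\<close>

lemma endpoint_in_limit_set_finite:
  assumes "T > 0" and mono: "mono_on (horizon S) \<phi>0" and S: "0 < S" "S < \<infinity>"
    and \<tau>: "\<And>t. 0 \<le> t \<Longrightarrow> t < T \<Longrightarrow> \<tau> t \<in> horizon S \<and> \<phi>0 (\<tau> t) = t"
    and "no_final_loop T \<phi>0 S" and lim: "(f \<longlongrightarrow> p) (to_end S)"
  shows "p \<in> limit_set (ereal T) (\<lambda>t. f (\<tau> t))"
proof -
  obtain r where r: "S = ereal r" "r > 0" using S by (cases S) auto
  have "\<forall>\<^sub>F t in at_left T. 0 < t" using \<open>T > 0\<close> by (rule order_tendstoD(1)[OF tendsto_ident_at])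
  then have ev: "\<forall>\<^sub>F t in at_left T. 0 < t \<and> t < T"
    by (intro eventually_conj) (auto simp: eventually_at_filter)
  have "\<forall>\<^sub>F t in at_left T. \<tau> t < r"
    using ev by eventually_elim (use \<tau> r in \<open>auto simp: horizon_def\<close>)
  moreover have "(\<tau> \<longlongrightarrow> r) (at_left T)"
  proof (rule order_tendstoI)
    fix c assume "c < r"
    let ?s = "max c 0"
    have s: "?s \<in> horizon S" using \<open>c < r\<close> r by (auto simp: horizon_def)
    then have "\<phi>0 ?s < T" using assms(6) S unfolding no_final_loop_def by blast
    then have "\<forall>\<^sub>F t in at_left T. \<phi>0 ?s < t" by (rule order_tendstoD(1)[OF tendsto_ident_at])
    with ev show "\<forall>\<^sub>F t in at_left T. c < \<tau> t"
    proof eventually_elim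
      case (elim t)
      then have "\<not> \<tau> t \<le> ?s" using \<tau>[of t] mono_onD[OF mono, of "\<tau> t" ?s] s by auto
      then show ?case by simp
    qed
  next
    fix c assume "r < c"
    then show "\<forall>\<^sub>F t in at_left T. \<tau> t < c" using calculation by (auto elim: eventually_mono)
  qed
  ultimately have "filterlim \<tau> (at_left r) (at_left T)" by (rule tendsto_imp_filterlim_at_left[rotated])
  moreover have "(f \<longlongrightarrow> p) (at_left r)" using lim r by (simp add: to_end_def)
  ultimately show ?thesis
    by (intro limit_set_if_tendsto_at_left \<open>T > 0\<close>) (rule filterlim_compose)
qed

lemma endpoint_in_limit_set_infinite:
  fixes f :: "real \<Rightarrow> 'a::real_normed_vector"
  assumes "T > 0" and mono: "mono_on {0..} \<phi>0" and \<phi>0: "\<phi>0 0 = 0" "(\<phi>0 \<longlongrightarrow> T) at_top"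
    and short: "\<And>e. e > 0 \<Longrightarrow> \<exists>K\<ge>0. \<forall>a b. K \<le> a \<and> a \<le> b \<and> \<phi>0 a = \<phi>0 b \<longrightarrow> b - a < e"
    and \<tau>: "\<And>t. 0 \<le> t \<Longrightarrow> t < T \<Longrightarrow> 0 \<le> \<tau> t \<and> \<phi>0 (\<tau> t) = t"
    and lip: "\<And>r s. 0 \<le> r \<Longrightarrow> 0 \<le> s \<Longrightarrow> dist (f r) (f s) \<le> C * dist r s"
    and lim: "p \<in> limit_set \<infinity> f"
  shows "p \<in> limit_set (ereal T) (\<lambda>t. f (\<tau> t))"
proof -
  obtain s :: "nat \<Rightarrow> real" where s: "range s \<subseteq> horizon \<infinity>" "incseq s"
      "(\<lambda>j. ereal (s j)) \<longlonglongrightarrow> \<infinity>" and fs: "(\<lambda>j. f (s j)) \<longlonglongrightarrow> p"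
    using lim unfolding limit_set_def by blast
  have s0: "0 \<le> s j" for j using s(1) by (auto simp: horizon_def)
  have leT: "\<phi>0 r \<le> T" if "0 \<le> r" for r
  proof (rule tendsto_lowerbound[OF \<phi>0(2)])
    show "\<forall>\<^sub>F q in at_top. \<phi>0 r \<le> \<phi>0 q"
      using eventually_ge_at_top[of r] by eventually_elim (use that mono_onD[OF mono, of r] in auto)
  qed simp
  \<comment> \<open>If the value \<open>T\<close> were attained, \<open>\<phi>0\<close> would stay
    there, and a flat interval of length 1 beyond any \<open>K\<close> would contradict
    \<open>short\<close>. The strictness keeps the times \<open>t j\<close> inside the domain of the
    clock.\<close>
  have ltT: "\<phi>0 r < T" if "0 \<le> r" for r
  proof (rule ccontr)
    assume "\<not> \<phi>0 r < T"
    then have T: "\<phi>0 q = T" if "r \<le> q" for q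
      using mono_onD[OF mono, of r q] leT[of q] that \<open>0 \<le> r\<close> by auto
    obtain K where "\<forall>a b. K \<le> a \<and> a \<le> b \<and> \<phi>0 a = \<phi>0 b \<longrightarrow> b - a < 1" using short[of 1] by auto
    from this[rule_format, of "max K r" "max K r + 1"] show False using T by auto
  qed
  define t where "t j = \<phi>0 (s j)" for j
  have t: "0 \<le> t j" "t j < T" for j
    using mono_onD[OF mono, of 0 "s j"] \<phi>0(1) s0 ltT by (auto simp: t_def)
  have "filterlim s at_top sequentially" using s(3) by (simp add: tendsto_PInfty_eq_at_top)
  then have tT: "t \<longlonglongrightarrow> T" unfolding t_def[abs_def] by (rule filterlim_compose[OF \<phi>0(2)])
  have "(\<lambda>j. dist (\<tau> (t j)) (s j)) \<longlonglongrightarrow> 0"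
  proof (rule tendstoI)
    fix e :: real assume "e > 0"
    then obtain K where "K \<ge> 0" and "\<forall>a b. K \<le> a \<and> a \<le> b \<and> \<phi>0 a = \<phi>0 b \<longrightarrow> b - a < e"
      using short[OF \<open>e > 0\<close>] by blast
    then have K: "b - a < e" if "K \<le> a" "a \<le> b" "\<phi>0 a = \<phi>0 b" for a b using that by blast
    \<comment> \<open>A time above \<open>\<phi>0 K\<close> forces both \<open>s j\<close> and
      \<open>\<tau> (t j)\<close> beyond \<open>K\<close>. They share their value of
      \<open>\<phi>0\<close>, and either may be the larger, so \<open>K\<close> is used in both
      orders.\<close>
    have "\<forall>\<^sub>F j in sequentially. \<phi>0 K < t j" using order_tendstoD(1)[OF tT ltT[OF \<open>K \<ge> 0\<close>]] .
    then show "\<forall>\<^sub>F j in sequentially. dist (dist (\<tau> (t j)) (s j)) 0 < e"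
    proof eventually_elim
      case (elim j)
      have \<tau>j: "0 \<le> \<tau> (t j)" "\<phi>0 (\<tau> (t j)) = \<phi>0 (s j)" using \<tau>[OF t] by (auto simp: t_def)
      have "\<not> s j \<le> K" using elim mono_onD[OF mono, of "s j" K] s0 \<open>K \<ge> 0\<close> by (auto simp: t_def)
      moreover have "\<not> \<tau> (t j) \<le> K"
        using elim mono_onD[OF mono, of "\<tau> (t j)" K] \<tau>j \<open>K \<ge> 0\<close> by (auto simp: t_def)
      ultimately show ?case
        using K[of "s j" "\<tau> (t j)"] K[of "\<tau> (t j)" "s j"] \<tau>j by (auto simp: dist_real_def abs_if)
    qed
  qed
  then have "(\<lambda>j. C * dist (\<tau> (t j)) (s j)) \<longlonglongrightarrow> 0" by (rule tendsto_mult_right_zero)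
  then have "(\<lambda>j. f (\<tau> (t j)) - f (s j)) \<longlonglongrightarrow> 0"
    by (rule Lim_null_comparison[rotated])
      (use lip \<tau>[OF t] s0 in \<open>auto intro!: always_eventually simp flip: dist_norm\<close>)
  from tendsto_add[OF this fs] have "(\<lambda>j. f (\<tau> (t j))) \<longlonglongrightarrow> p" by simp
  moreover have "incseq t"
    using mono_onD[OF mono] s0 incseqD[OF s(2)] by (auto simp: incseq_def t_def)
  ultimately show ?thesis
    unfolding limit_set_def using tT t by (auto simp: horizon_def intro!: exI[of _ t])
qed

lemma BV_loops_endpoint:
  assumes "T > 0" and "compact U"
    and growth: "\<And>x u v. u \<in> U \<Longrightarrow> v \<in> V \<Longrightarrow>
           norm (g0 x u v, (\<chi> i. g i x u)) \<le> M * (1 + norm (x, u))" and "M > 0"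
    and assoc: "associated_solution g0 g U V T x0 u0 u v \<phi>0 \<phi> \<psi> S \<sigma> x"
    and loops: "has_BV_loops \<phi>0 S" "no_final_loop T \<phi>0 S"
  shows "(x T, u T) \<in> limit_set (ereal T) (\<lambda>t. (x t, u t))"
proof -
  obtain \<xi> \<tau> where compl: "BV_loc_graph_completion U V T u0 u v \<phi>0 \<phi> \<psi> S"
    and \<xi>: "space_time_solution g0 g x0 \<phi>0 \<phi> \<psi> S \<xi>"
    and \<tau>: "\<And>t. 0 \<le> t \<Longrightarrow> t < T \<Longrightarrow>
      \<tau> t \<in> horizon S \<and> \<phi>0 (\<tau> t) = t \<and> \<phi> (\<tau> t) = u t \<and> x t = \<xi> (\<tau> t)"
    and bdd: "bounded (\<xi> ` horizon S)" and fin: "S < \<infinity> \<Longrightarrow> (\<xi> \<longlongrightarrow> x T) (to_end S)"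
    and inf: "S = \<infinity> \<Longrightarrow> (x T, u T) \<in> limit_set \<infinity> (\<lambda>s. (\<xi> s, \<phi> s))"
    using associated_solution_real_clock[OF assoc \<open>T > 0\<close>] by blast
  have feas: "(\<phi>0, \<phi>, \<psi>, S) \<in> feasible_space_time_controls U V T u0" and ends: "ends_at \<phi>0 \<phi> S T (u T)"
    using compl by (auto simp: BV_loc_graph_completion_def)
  have mono: "mono_on (horizon S) \<phi>0" using feas by (rule feasible_mono)
  \<comment> \<open>The pair of \<open>\<xi>\<close> and \<open>\<phi>\<close> is treated as one
    map, so that a single sequence of times serves both components.\<close>
  have "(x T, u T) \<in> limit_set (ereal T) (\<lambda>t. (\<xi> (\<tau> t), \<phi> (\<tau> t)))"
  proof (cases "S = \<infinity>")
    case False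
    then have "S < \<infinity>" by simp
    moreover have "0 < S" using feas by (simp add: feasible_space_time_controls_def)
    moreover have "((\<lambda>s. (\<xi> s, \<phi> s)) \<longlongrightarrow> (x T, u T)) (to_end S)"
      using fin ends \<open>S < \<infinity>\<close> by (intro tendsto_Pair) (auto simp: ends_at_def)
    ultimately show ?thesis
      using endpoint_in_limit_set_finite[OF \<open>T > 0\<close> mono, of \<tau> "\<lambda>s. (\<xi> s, \<phi> s)"] \<tau> loops(2) by blast
  next
    case True
    have H: "horizon S = {0..}" using True by (auto simp: horizon_def)
    obtain C where "C \<ge> 0" and C: "\<And>r s. 0 \<le> r \<Longrightarrow> 0 \<le> s \<Longrightarrow> dist (\<xi> r) (\<xi> s) \<le> C * dist r s"
      using space_time_solution_lipschitz[OF \<open>compact U\<close> growth \<open>M > 0\<close> feas \<xi> bdd] unfolding H by auto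
    have \<phi>0lip: "dist (\<phi>0 r) (\<phi>0 s) \<le> dist r s" and \<phi>lip: "dist (\<phi> r) (\<phi> s) \<le> dist r s"
      if "0 \<le> r" "0 \<le> s" for r s
      using feasible_lipschitz[OF feas, of r s] that H by auto
    obtain N where "negligible N" "\<And>s. s \<in> {0..} - N \<Longrightarrow> \<exists>a. (\<phi>0 has_real_derivative a) (at s)"
      using feasible_solution_ae[OF feas \<xi>] unfolding H by blast
    moreover have "continuous_on {0..} \<phi>0"
      using \<phi>0lip by (intro lipschitz_on_continuous_on[where L = 1] lipschitz_onI) auto
    ultimately have "{s. 0 \<le> s \<and> (\<phi>0 has_real_derivative 0) (at s)} \<in> sets lebesgue"
      by (intro deriv_zero_set_lebesgue)
    moreover have "emeasure lebesgue {s. 0 \<le> s \<and> (\<phi>0 has_real_derivative 0) (at s)} < \<infinity>"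
      using loops(1) True by (simp add: has_BV_loops_def)
    ultimately have short: "\<exists>K\<ge>0. \<forall>a b. K \<le> a \<and> a \<le> b \<and> \<phi>0 a = \<phi>0 b \<longrightarrow> b - a < e" if "e > 0" for e
      using mono that unfolding H by (intro flat_intervals_short)
    have lip: "dist (\<xi> r, \<phi> r) (\<xi> s, \<phi> s) \<le> (C + 1) * dist r s" if rs: "0 \<le> r" "0 \<le> s" for r s
    proof -
      have "dist (\<xi> r, \<phi> r) (\<xi> s, \<phi> s) \<le> dist (\<xi> r) (\<xi> s) + dist (\<phi> r) (\<phi> s)"
        unfolding dist_Pair_Pair by (rule sqrt_sum_squares_le_sum) auto
      also have "\<dots> \<le> (C + 1) * dist r s" using C[OF rs] \<phi>lip[OF rs] by (simp add: algebra_simps)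
      finally show ?thesis .
    qed
    show ?thesis
    proof (rule endpoint_in_limit_set_infinite[OF \<open>T > 0\<close> _ _ _ short])
      show "mono_on {0..} \<phi>0" using mono H by simp
      show "\<phi>0 0 = 0" "(\<phi>0 \<longlongrightarrow> T) at_top"
        using feas True by (auto simp: feasible_space_time_controls_def to_end_def)
      show "0 \<le> \<tau> t \<and> \<phi>0 (\<tau> t) = t" if "0 \<le> t" "t < T" for t using \<tau>[OF that] H by auto
      show "dist (\<xi> r, \<phi> r) (\<xi> s, \<phi> s) \<le> (C + 1) * dist r s" if "0 \<le> r" "0 \<le> s" for r s
        using lip that .
      show "(x T, u T) \<in> limit_set \<infinity> (\<lambda>s. (\<xi> s, \<phi> s))" using inf True .
    qed
  qed
  moreover have "limit_set (ereal T) (\<lambda>t. (\<xi> (\<tau> t), \<phi> (\<tau> t))) = limit_set (ereal T) (\<lambda>t. (x t, u t))"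
  proof -
    have "(\<xi> (\<tau> (s j)), \<phi> (\<tau> (s j))) = (x (s j), u (s j))" if "range s \<subseteq> horizon (ereal T)" for s :: "nat \<Rightarrow> real" and j
      using \<tau>[of "s j"] subsetD[OF that rangeI[of s j]] by (simp add: mem_horizon_ereal)
    then show ?thesis unfolding limit_set_def by (auto cong: conj_cong)
  qed
  ultimately show ?thesis by simp
qed

theorem theorem2p2:
  fixes T :: real
    and U :: "(real^'m) set" and V :: "(real^'l) set"
    and x0 :: "real^'n" and u0 :: "real^'m"
    and g0 :: "real^'n \<Rightarrow> real^'m \<Rightarrow> real^'l \<Rightarrow> real^'n"
    and g :: "'m \<Rightarrow> real^'n \<Rightarrow> real^'m \<Rightarrow> real^'n"
    and M :: real
    and u :: "real \<Rightarrow> real^'m" and v :: "real \<Rightarrow> real^'l"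
    and x :: "real \<Rightarrow> real^'n"
  assumes "T > 0" and "compact U" and "compact V" and "u0 \<in> U"
    and "continuous_on (UNIV \<times> U \<times> V) (\<lambda>(x, u, v). g0 x u v)"
    and "locally_lipschitz_uniformly_on (UNIV \<times> U) V (\<lambda>v (x, u). g0 x u v)"
    and "\<And>i. locally_lipschitz_uniformly_on (UNIV \<times> U) {i} (\<lambda>i (x, u). g i x u)"
    and "M > 0"
    and "\<And>x u v. u \<in> U \<Longrightarrow> v \<in> V \<Longrightarrow>
           norm (g0 x u v, (\<chi> i. g i x u)) \<le> M * (1 + norm (x, u))"
    and "u \<in> AC_loc_bar T U" and "v \<in> L1_controls T V" and "u 0 = u0"
    and "BV_loc_graph_completion_solution g0 g U V T x0 u0 u v x"
    and "AC_loc (ereal T) x"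
  shows "coincides_with_trajectory g0 g T x0 u v x \<and>
    ((\<exists>\<phi>0 \<phi> \<psi> S \<sigma>. associated_solution g0 g U V T x0 u0 u v \<phi>0 \<phi> \<psi> S \<sigma> x \<and>
        has_BV_loops \<phi>0 S \<and> no_final_loop T \<phi>0 S)
       \<longrightarrow> AC_loc_solution g0 g T x0 u v x) \<and>
    (AC_loc_solution g0 g T x0 u v x \<longleftrightarrow>
       (x T, u T) \<in> limit_set (ereal T) (\<lambda>t. (x t, u t)))"
proof -
  obtain \<phi>0 \<phi> \<psi> S \<sigma> where assoc: "associated_solution g0 g U V T x0 u0 u v \<phi>0 \<phi> \<psi> S \<sigma> x"
    using assms(13) unfolding BV_loc_graph_completion_solution_def by blast
  obtain \<xi> \<tau> where compl: "BV_loc_graph_completion U V T u0 u v \<phi>0 \<phi> \<psi> S"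
    and \<xi>: "space_time_solution g0 g x0 \<phi>0 \<phi> \<psi> S \<xi>"
    and \<tau>: "\<And>t. 0 \<le> t \<Longrightarrow> t < T \<Longrightarrow>
      \<tau> t \<in> horizon S \<and> \<phi>0 (\<tau> t) = t \<and> \<phi> (\<tau> t) = u t \<and> x t = \<xi> (\<tau> t)"
    and "\<tau> 0 = 0" and bdd: "bounded (\<xi> ` horizon S)"
    using associated_solution_real_clock[OF assoc \<open>T > 0\<close>] by blast
  have car: "caratheodory_solution g0 g T x0 u v x"
    by (rule clock_solution_caratheodory[OF \<open>T > 0\<close> compl \<xi> \<tau> \<open>\<tau> 0 = 0\<close> assms(14)])
  have coincides: "coincides_with_trajectory g0 g T x0 u v x"
    unfolding coincides_with_trajectory_def
  proof (intro conjI allI impI ballI car)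
    fix y t assume "caratheodory_solution g0 g T x0 u v y" "t \<in> {0..<T}"
    then show "x t = y t"
      using caratheodory_solution_unique[OF assms(6,7) _ _ _ car] assms(10,11)
      by (auto simp: AC_loc_bar_def L1_controls_def image_subset_iff)
  qed
  have "x ` {0..<T} \<subseteq> \<xi> ` horizon S" using \<tau> by auto
  then have "bounded (x ` {0..<T})" using bdd bounded_subset by blast
  \<comment> \<open>Coincidence with the trajectory and boundedness are already established, so the
    endpoint condition is all that is left of the definition.\<close>
  then have iff: "AC_loc_solution g0 g T x0 u v x \<longleftrightarrow>
       (x T, u T) \<in> limit_set (ereal T) (\<lambda>t. (x t, u t))"
    using coincides by (simp add: AC_loc_solution_def)
  \<comment> \<open>The completion and the clock are quantified afresh: the one with BV loops may
    differ from the one that was used to derive the equation for \<open>x\<close>.\<close>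
  have "AC_loc_solution g0 g T x0 u v x"
    if "associated_solution g0 g U V T x0 u0 u v \<phi>0 \<phi> \<psi> S \<sigma> x" "has_BV_loops \<phi>0 S" "no_final_loop T \<phi>0 S"
    for \<phi>0 \<phi> \<psi> S \<sigma>
    unfolding iff using assms(1,2,9,8) that by (rule BV_loops_endpoint)
  then show ?thesis
    by (intro conjI coincides iff impI) (elim exE conjE)
qed

end
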